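(* Let $0<H<1$ and let $X=(X(t))_{t\ge 0}$ be a fractional Brownian motion with Hurst parameter $H$. Set $X_1^*:=\sup_{0\le t\le 1}X(t)$. Then there is a constant $c>0$ such that, for all small enough $\varepsilon>0$, $$ \varepsilon^{(1-H)/H}\,|\log\varepsilon|^{-c}\;\le\;\mathbb{P}\left[X_1^*\le\varepsilon\right]\;\le\;\varepsilon^{(1-H)/H}\,|\log\varepsilon|^{c}. $$
   Context: Fractional Brownian motion with Hurst parameter $H\in(0,1)$ is the centered Gaussian process $X$ with covariance $\mathbb{E}[X(t)X(s)]=\frac12\left(|t|^{2H}+|s|^{2H}-|t-s|^{2H}\right)$; as usual, a version with continuous paths is taken. *)

theory Defs
  imports "HOL-Probability.Probability"
begin

text \<open>Almost surely constant variables count as Gaussian (variance zero). They do occur below: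
  fractional Brownian motion vanishes almost surely at time 0.\<close>

definition gaussian_rv :: "'a measure \<Rightarrow> ('a \<Rightarrow> real) \<Rightarrow> bool" where
  "gaussian_rv M Y \<longleftrightarrow> Y \<in> borel_measurable M \<and>
     ((\<exists>\<mu>. AE \<omega> in M. Y \<omega> = \<mu>) \<or>
      (\<exists>\<mu> \<sigma>. \<sigma> > 0 \<and> distributed M lborel Y (normal_density \<mu> \<sigma>)))"

definition gaussian_process :: "'a measure \<Rightarrow> 'i set \<Rightarrow> ('i \<Rightarrow> 'a \<Rightarrow> real) \<Rightarrow> bool" where
  "gaussian_process M T X \<longleftrightarrow>
     (\<forall>S a. finite S \<and> S \<subseteq> T \<longrightarrow> gaussian_rv M (\<lambda>\<omega>. \<Sum>t\<in>S. a t * X t \<omega>))"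

definition centered_process :: "'a measure \<Rightarrow> 'i set \<Rightarrow> ('i \<Rightarrow> 'a \<Rightarrow> real) \<Rightarrow> bool" where
  "centered_process M T X \<longleftrightarrow> (\<forall>t\<in>T. prob_space.expectation M (X t) = 0)"

text \<open>Continuity is required of every path, so that \<open>SUP t\<in>{0..1}. X t \<omega>\<close> is
  the supremum of a bounded set for every \<open>\<omega>\<close> in the sample space. Values of \<open>X\<close> at negative times
  are irrelevant.\<close>

definition fractional_brownian_motion :: "'a measure \<Rightarrow> real \<Rightarrow> (real \<Rightarrow> 'a \<Rightarrow> real) \<Rightarrow> bool" where
  "fractional_brownian_motion M H X \<longleftrightarrow>
     gaussian_process M {0..} X \<and>
     centered_process M {0..} X \<and>
     (\<forall>t\<ge>0. \<forall>s\<ge>0. prob_space.expectation M (\<lambda>\<omega>. X t \<omega> * X s \<omega>) =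
        (\<bar>t\<bar> powr (2 * H) + \<bar>s\<bar> powr (2 * H) - \<bar>t - s\<bar> powr (2 * H)) / 2) \<and>
     (\<forall>\<omega>\<in>space M. continuous_on {0..} (\<lambda>t. X t \<omega>))"

end

theory Submission
  imports Defs "HOL-Real_Asymp.Real_Asymp"
begin

text \<open>Rescaling the values on the grid \<open>k / n\<close> gives a Gaussian walk \<open>Y\<close> with the covariance of fractional
  Brownian motion at integer times. Let \<open>mean_log n\<close> be the mean of \<open>ln (\<Sum>k<n. exp (Y k))\<close>. Up to logarithms
  it has order \<open>n powr H\<close>, and reversing time shows that its increments are
  \<open>mean_gain n = E (ln (1 + 1 / (\<Sum>k=1..n. exp (Y k))))\<close>, which decrease in \<open>n\<close>; hence \<open>mean_gain n\<close> has order
  \<open>n powr (H - 1)\<close> up to logarithms. A walk that stays below \<open>ln n\<close> is the only substantial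
  contribution to \<open>mean_gain n\<close>, which bounds the persistence probability from below. Conversely, a Cameron-Martin
  shift of negligible cost turns a walk that stays below 1 into one with a small exponential sum,
  which gives the upper bound. Only the lower bound needs continuous time: chaining controls the path between
  grid points.\<close>

text \<open>Molchan's identity controls the mean of \<open>ln (1 + 1 / expsum1 n \<omega>)\<close>,
  not a probability, and a walk that stays below 1 may still have an exponential sum of order
  \<open>n\<close>; this is why the upper bound needs a shift. The mean logarithm is known only up
  to a factor \<open>ln n\<close>, so its values are compared at two times whose ratio is a power of
  \<open>ln n\<close>. This comparison, and the tilt at a time that is a power of
  \<open>ln n\<close>, are the main sources of the logarithms in the result. By self-similarity a
  level \<open>\<epsilon>\<close> calls for a grid of about \<open>\<epsilon> powr (- 1 / H)\<close>
  points, and \<open>n powr (H - 1)\<close> becomes \<open>\<epsilon> powr ((1 - H) / H)\<close>.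
  The hypothesis speaks only of one-dimensional laws of linear combinations. Reversal, independence
  and Cameron-Martin concern whole vectors, so joint laws are first recovered from the means of
  cosines and sines of linear combinations. The argument never uses the sign of the correlation
  between increments, so \<open>H\<close> below and above 1/2 are treated alike.\<close>

section \<open>Laws determined by trigonometric expectations\<close>

text \<open>The weight is normalised because Levy uniqueness speaks of probability laws. The
  characteristic function is split into real cosine and sine integrals, the data available for
  Gaussian vectors, and the last part recovers weighted indicators from the law.\<close>

lemma (in finite_measure) weighted_law:
  fixes w U :: "'a \<Rightarrow> real"
  assumes [measurable]: "w \<in> borel_measurable M" "U \<in> borel_measurable M"
    and w: "\<And>\<omega>. \<omega> \<in> space M \<Longrightarrow> 0 \<le> w \<omega>" "\<And>\<omega>. \<omega> \<in> space M \<Longrightarrow> w \<omega> \<le> C"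
    and m: "(\<integral>\<omega>. w \<omega> \<partial>M) = m" "m > 0"
  defines "\<mu> \<equiv> distr (density M (\<lambda>\<omega>. ennreal (w \<omega> / m))) borel U"
  shows "real_distribution \<mu>"
    and "char \<mu> s = (complex_of_real (\<integral>\<omega>. w \<omega> * cos (s * U \<omega>) \<partial>M) + \<i> * complex_of_real (\<integral>\<omega>. w \<omega> * sin (s * U \<omega>) \<partial>M)) / m"
    and "B \<in> sets borel \<Longrightarrow> measure \<mu> B = (\<integral>\<omega>. w \<omega> * indicator B (U \<omega>) \<partial>M) / m"
proof -
  have wa: "AE \<omega> in M. 0 \<le> w \<omega>" using w by auto
  have wb: "AE \<omega> in M. norm (w \<omega>) \<le> C" using w by auto
  have wm: "AE \<omega> in M. 0 \<le> w \<omega> / m" using w m by auto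
  have iw: "integrable M w" by (rule integrable_const_bound[OF wb]) simp
  have "emeasure (density M (\<lambda>\<omega>. ennreal (w \<omega> / m))) (space M) = ennreal (\<integral>\<omega>. w \<omega> / m \<partial>M)"
    using iw wm by (subst emeasure_density) (auto simp: nn_integral_eq_integral cong: nn_integral_cong)
  also have "\<dots> = 1" using m by simp
  finally interpret D: prob_space "density M (\<lambda>\<omega>. ennreal (w \<omega> / m))"
    by (intro prob_spaceI) simp
  show "real_distribution \<mu>" unfolding \<mu>_def by (intro D.real_distribution_distr) simp
  have ic: "integrable M (\<lambda>\<omega>. w \<omega> * cos (s * U \<omega>))" "integrable M (\<lambda>\<omega>. w \<omega> * sin (s * U \<omega>))"
    by (rule Bochner_Integration.integrable_bound[OF iw]; auto simp: abs_mult mult_left_le)+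
  have "char \<mu> s = (\<integral>\<omega>. (w \<omega> / m) *\<^sub>R iexp (s * U \<omega>) \<partial>M)"
    unfolding char_def \<mu>_def
    by (subst integral_distr) (auto simp: wm integral_density)
  also have "\<dots> = (\<integral>\<omega>. (complex_of_real (w \<omega> * cos (s * U \<omega>)) + \<i> * complex_of_real (w \<omega> * sin (s * U \<omega>))) / m \<partial>M)"
    by (intro Bochner_Integration.integral_cong) (auto simp: complex_eq_iff Re_exp Im_exp)
  also have "\<dots> = (complex_of_real (\<integral>\<omega>. w \<omega> * cos (s * U \<omega>) \<partial>M) + \<i> * complex_of_real (\<integral>\<omega>. w \<omega> * sin (s * U \<omega>) \<partial>M)) / m"
    using ic by (simp del: of_real_mult)
  finally show "char \<mu> s = (complex_of_real (\<integral>\<omega>. w \<omega> * cos (s * U \<omega>) \<partial>M) + \<i> * complex_of_real (\<integral>\<omega>. w \<omega> * sin (s * U \<omega>) \<partial>M)) / m" .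
  show "measure \<mu> B = (\<integral>\<omega>. w \<omega> * indicator B (U \<omega>) \<partial>M) / m" if [measurable]: "B \<in> sets borel"
  proof -
    interpret D': prob_space \<mu> unfolding \<mu>_def by (intro D.prob_space_distr) simp
    have "measure \<mu> B = (\<integral>x. indicator B x \<partial>\<mu>)" unfolding \<mu>_def by simp
    also have "\<dots> = (\<integral>\<omega>. (w \<omega> / m) *\<^sub>R indicator B (U \<omega>) \<partial>M)"
      unfolding \<mu>_def by (subst integral_distr) (auto simp: wm integral_density)
    also have "\<dots> = (\<integral>\<omega>. w \<omega> * indicator B (U \<omega>) / m \<partial>M)" by simp
    finally show ?thesis by simp
  qed
qed

text \<open>The cosine integrals at \<open>s = 0\<close> say that both weights have the same total
  mass. Mass zero makes both weights vanish almost everywhere; otherwise the two normalised laws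
  have the same characteristic function.\<close>

lemma weighted_law_eq:
  fixes w U :: "'a \<Rightarrow> real" and w' U' :: "'b \<Rightarrow> real"
  assumes "finite_measure M" "finite_measure N"
    and [measurable]: "w \<in> borel_measurable M" "U \<in> borel_measurable M" "w' \<in> borel_measurable N" "U' \<in> borel_measurable N"
    and w: "\<And>\<omega>. \<omega> \<in> space M \<Longrightarrow> 0 \<le> w \<omega>" "\<And>\<omega>. \<omega> \<in> space M \<Longrightarrow> w \<omega> \<le> C"
    and w': "\<And>\<omega>. \<omega> \<in> space N \<Longrightarrow> 0 \<le> w' \<omega>" "\<And>\<omega>. \<omega> \<in> space N \<Longrightarrow> w' \<omega> \<le> C"
    and c: "\<And>s. (\<integral>\<omega>. w \<omega> * cos (s * U \<omega>) \<partial>M) = (\<integral>\<omega>. w' \<omega> * cos (s * U' \<omega>) \<partial>N)"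
    and s: "\<And>s. (\<integral>\<omega>. w \<omega> * sin (s * U \<omega>) \<partial>M) = (\<integral>\<omega>. w' \<omega> * sin (s * U' \<omega>) \<partial>N)"
    and B: "B \<in> sets borel"
  shows "(\<integral>\<omega>. w \<omega> * indicator B (U \<omega>) \<partial>M) = (\<integral>\<omega>. w' \<omega> * indicator B (U' \<omega>) \<partial>N)"
proof -
  interpret M: finite_measure M by fact
  interpret N: finite_measure N by fact
  note B[measurable]
  define m where "m = (\<integral>\<omega>. w \<omega> \<partial>M)"
  have m': "m = (\<integral>\<omega>. w' \<omega> \<partial>N)" using c[of 0] by (simp add: m_def)
  have m0: "m \<ge> 0" unfolding m_def by (intro integral_nonneg_AE) (use w in auto)
  have iw: "integrable M w" by (rule M.integrable_const_bound[of _ C]) (use w in auto)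
  have iw': "integrable N w'" by (rule N.integrable_const_bound[of _ C]) (use w' in auto)
  show ?thesis
  proof (cases "m = 0")
    case True
    have "AE \<omega> in M. w \<omega> = 0"
      using True m_def w iw by (subst integral_nonneg_eq_0_iff_AE[symmetric]) auto
    moreover have "AE \<omega> in N. w' \<omega> = 0"
      using True m' w' iw' by (subst integral_nonneg_eq_0_iff_AE[symmetric]) auto
    ultimately
    have "(\<integral>\<omega>. w \<omega> * indicator B (U \<omega>) \<partial>M) = 0" "(\<integral>\<omega>. w' \<omega> * indicator B (U' \<omega>) \<partial>N) = 0"
      by (auto intro!: integral_eq_zero_AE)
    then show ?thesis by simp
  next
    case False
    then have mp: "m > 0" using m0 by simp
    note l = M.weighted_law[of w U C m, OF _ _ w m_def[symmetric] mp]
    note l' = N.weighted_law[of w' U' C m, OF _ _ w' m'[symmetric] mp]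
    have "distr (density M (\<lambda>\<omega>. ennreal (w \<omega> / m))) borel U = distr (density N (\<lambda>\<omega>. ennreal (w' \<omega> / m))) borel U'"
      by (intro Levy_uniqueness l(1) l'(1) ext) (simp_all add: l(2) l'(2) c s)
    then show ?thesis using l(3)[OF _ _ _ _ B] l'(3)[OF _ _ _ _ B] mp by auto
  qed
qed

text \<open>Coordinates are moved one at a time from the trigonometric argument into the indicators. The
  weights \<open>1 + cos V\<close> and \<open>1 + sin V\<close> are nonnegative, so that one-dimensional uniqueness applies to
  the law of the moved coordinate under the weighted measure.\<close>

lemma rectangle_trig_eq:
  fixes X :: "'i \<Rightarrow> 'a \<Rightarrow> real" and Y :: "'i \<Rightarrow> 'b \<Rightarrow> real"
  assumes "finite_measure M" "finite_measure N" and "finite I"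
    and [measurable]: "\<And>i. i \<in> I \<Longrightarrow> X i \<in> borel_measurable M" "\<And>i. i \<in> I \<Longrightarrow> Y i \<in> borel_measurable N"
    and c: "\<And>a. (\<integral>\<omega>. cos (\<Sum>i\<in>I. a i * X i \<omega>) \<partial>M) = (\<integral>\<omega>. cos (\<Sum>i\<in>I. a i * Y i \<omega>) \<partial>N)"
    and s: "\<And>a. (\<integral>\<omega>. sin (\<Sum>i\<in>I. a i * X i \<omega>) \<partial>M) = (\<integral>\<omega>. sin (\<Sum>i\<in>I. a i * Y i \<omega>) \<partial>N)"
    and B: "\<And>i. i \<in> I \<Longrightarrow> B i \<in> sets borel"
    and J: "finite J" "J \<subseteq> I"
  shows "(\<integral>\<omega>. (\<Prod>i\<in>J. indicator (B i) (X i \<omega>)) * cos (\<Sum>i\<in>I-J. a i * X i \<omega>) \<partial>M)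
       = (\<integral>\<omega>. (\<Prod>i\<in>J. indicator (B i) (Y i \<omega>)) * cos (\<Sum>i\<in>I-J. a i * Y i \<omega>) \<partial>N)" (is "?C J a")
    and "(\<integral>\<omega>. (\<Prod>i\<in>J. indicator (B i) (X i \<omega>)) * sin (\<Sum>i\<in>I-J. a i * X i \<omega>) \<partial>M)
       = (\<integral>\<omega>. (\<Prod>i\<in>J. indicator (B i) (Y i \<omega>)) * sin (\<Sum>i\<in>I-J. a i * Y i \<omega>) \<partial>N)" (is "?S J a")
proof -
  interpret M: finite_measure M by fact
  interpret N: finite_measure N by fact
  have "\<forall>a. ?C J a \<and> ?S J a"
    using J
  proof (induction J rule: finite_induct)
    case empty
    then show ?case using c s by simp
  next
    case (insert j J)
    then have jI: "j \<in> I" and JI: "J \<subseteq> I" and "finite J" by auto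
    have [measurable]: "\<And>i. i \<in> J \<Longrightarrow> B i \<in> sets borel" "B j \<in> sets borel" using B JI jI by auto
    have [measurable]: "\<And>i. i \<in> J \<Longrightarrow> X i \<in> borel_measurable M" "\<And>i. i \<in> J \<Longrightarrow> Y i \<in> borel_measurable N"
      "X j \<in> borel_measurable M" "Y j \<in> borel_measurable N"
      "\<And>i. i \<in> I - insert j J \<Longrightarrow> X i \<in> borel_measurable M" "\<And>i. i \<in> I - insert j J \<Longrightarrow> Y i \<in> borel_measurable N"
      using JI jI by auto
    have fin: "finite (I - insert j J)" using \<open>finite I\<close> by simp
    define WX where "WX \<omega> = (\<Prod>i\<in>J. indicator (B i) (X i \<omega>) :: real)" for \<omega>
    define WY where "WY \<omega> = (\<Prod>i\<in>J. indicator (B i) (Y i \<omega>) :: real)" for \<omega>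
    have [measurable]: "WX \<in> borel_measurable M" "WY \<in> borel_measurable N"
      unfolding WX_def WY_def by measurable
    have WX: "0 \<le> WX \<omega>" "WX \<omega> \<le> 1" and WY: "0 \<le> WY \<omega>'" "WY \<omega>' \<le> 1" for \<omega> \<omega>'
      unfolding WX_def WY_def by (auto intro!: prod_nonneg prod_le_1)
    have eq: "I - J = insert j (I - insert j J)" using jI insert by auto
    { fix a
      define V where "V \<omega> = (\<Sum>i\<in>I - insert j J. a i * X i \<omega>)" for \<omega>
      define V' where "V' \<omega> = (\<Sum>i\<in>I - insert j J. a i * Y i \<omega>)" for \<omega>
      have V[measurable]: "V \<in> borel_measurable M" "V' \<in> borel_measurable N" unfolding V_def V'_def by measurable
      \<comment> \<open>Coefficient \<open>t\<close> on the coordinate being moved; the factor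
        \<open>e\<close> on the remaining sum will only be 0, 1 or -1.\<close>
      have sums: "(\<Sum>i\<in>I-J. (if i = j then t else e * a i) * X i \<omega>) = t * X j \<omega> + e * V \<omega>"
        "(\<Sum>i\<in>I-J. (if i = j then t else e * a i) * Y i \<omega>') = t * Y j \<omega>' + e * V' \<omega>'" for t e \<omega> \<omega>'
        unfolding eq V_def V'_def using fin
        by (auto simp: sum_distrib_left mult.assoc intro!: sum.cong)
      have IH: "(\<integral>\<omega>. WX \<omega> * cos (t * X j \<omega> + e * V \<omega>) \<partial>M) = (\<integral>\<omega>. WY \<omega> * cos (t * Y j \<omega> + e * V' \<omega>) \<partial>N)"
        "(\<integral>\<omega>. WX \<omega> * sin (t * X j \<omega> + e * V \<omega>) \<partial>M) = (\<integral>\<omega>. WY \<omega> * sin (t * Y j \<omega> + e * V' \<omega>) \<partial>N)" for t e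
        using insert.IH[OF JI, rule_format, of "\<lambda>i. if i = j then t else e * a i"]
        unfolding sums WX_def[symmetric] WY_def[symmetric] by auto
      note IH' = IH[of _ 0, simplified] IH[of _ 1, simplified] IH[of _ "-1", simplified]
      have iM: "integrable M (\<lambda>\<omega>. WX \<omega> * g \<omega>)" if [measurable]: "g \<in> borel_measurable M" and "\<And>\<omega>. \<bar>g \<omega>\<bar> \<le> 1" for g
        by (rule M.integrable_const_bound[of _ 1]) (use that WX in \<open>auto simp: abs_mult intro!: AE_I2 mult_le_one\<close>)
      have iN: "integrable N (\<lambda>\<omega>. WY \<omega> * g \<omega>)" if [measurable]: "g \<in> borel_measurable N" and "\<And>\<omega>. \<bar>g \<omega>\<bar> \<le> 1" for g
        by (rule N.integrable_const_bound[of _ 1]) (use that WY in \<open>auto simp: abs_mult intro!: AE_I2 mult_le_one\<close>)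
      \<comment> \<open>Product-to-sum formulas: a trigonometric integral against the weight
        \<open>1 + cos V\<close> or \<open>1 + sin V\<close> becomes a combination of instances of
        the induction hypothesis with \<open>e\<close> equal to 0, 1 and -1.\<close>
      have trig: "w * (1 + cos v) * cos u = w * cos (u + 0 * v) + (w * cos (u + 1 * v) + w * cos (u + (-1) * v)) / 2"
        "w * (1 + cos v) * sin u = w * sin (u + 0 * v) + (w * sin (u + 1 * v) + w * sin (u + (-1) * v)) / 2"
        "w * (1 + sin v) * cos u = w * cos (u + 0 * v) + (w * sin (u + 1 * v) - w * sin (u + (-1) * v)) / 2"
        "w * (1 + sin v) * sin u = w * sin (u + 0 * v) + (w * cos (u + (-1) * v) - w * cos (u + 1 * v)) / 2"
        for u v w :: real
        by (simp_all add: cos_add sin_add cos_diff sin_diff algebra_simps)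
      have bd: "0 \<le> WX \<omega> * (1 + c)" "WX \<omega> * (1 + c) \<le> 2" "0 \<le> WY \<omega>' * (1 + c)" "WY \<omega>' * (1 + c) \<le> 2"
        if "\<bar>c\<bar> \<le> 1" for c \<omega> \<omega>'
        using that WX[of \<omega>] WY[of \<omega>'] mult_mono[of "WX \<omega>" 1 "1 + c" 2] mult_mono[of "WY \<omega>'" 1 "1 + c" 2] by auto
      have 1: "(\<integral>\<omega>. WX \<omega> * (1 + cos (V \<omega>)) * indicator (B j) (X j \<omega>) \<partial>M)
            = (\<integral>\<omega>. WY \<omega> * (1 + cos (V' \<omega>)) * indicator (B j) (Y j \<omega>) \<partial>N)"
        by (rule weighted_law_eq[where C=2, OF \<open>finite_measure M\<close> \<open>finite_measure N\<close>])
          (simp_all add: bd trig IH' iM iN)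
      have 2: "(\<integral>\<omega>. WX \<omega> * (1 + sin (V \<omega>)) * indicator (B j) (X j \<omega>) \<partial>M)
            = (\<integral>\<omega>. WY \<omega> * (1 + sin (V' \<omega>)) * indicator (B j) (Y j \<omega>) \<partial>N)"
        by (rule weighted_law_eq[where C=2, OF \<open>finite_measure M\<close> \<open>finite_measure N\<close>])
          (simp_all add: bd trig IH' iM iN)
      have 3: "(\<integral>\<omega>. WX \<omega> * indicator (B j) (X j \<omega>) \<partial>M) = (\<integral>\<omega>. WY \<omega> * indicator (B j) (Y j \<omega>) \<partial>N)"
        by (rule weighted_law_eq[where C=1, OF \<open>finite_measure M\<close> \<open>finite_measure N\<close>])
          (use IH[of _ 0] WX WY in simp_all)
      have M3: "integrable M (\<lambda>\<omega>. WX \<omega> * indicator (B j) (X j \<omega>))" "integrable N (\<lambda>\<omega>. WY \<omega> * indicator (B j) (Y j \<omega>))"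
        by (auto intro!: iM iN split: split_indicator)
      have M4: "integrable M (\<lambda>\<omega>. WX \<omega> * (indicator (B j) (X j \<omega>) * cos (V \<omega>)))"
         "integrable M (\<lambda>\<omega>. WX \<omega> * (indicator (B j) (X j \<omega>) * sin (V \<omega>)))"
         "integrable N (\<lambda>\<omega>. WY \<omega> * (indicator (B j) (Y j \<omega>) * cos (V' \<omega>)))"
         "integrable N (\<lambda>\<omega>. WY \<omega> * (indicator (B j) (Y j \<omega>) * sin (V' \<omega>)))"
        by (auto intro!: iM iN split: split_indicator)
      \<comment> \<open>Subtracting identity \<open>3\<close> removes the 1 that made the weight
        nonnegative.\<close>
      have C: "(\<integral>\<omega>. WX \<omega> * (indicator (B j) (X j \<omega>) * cos (V \<omega>)) \<partial>M)
          = (\<integral>\<omega>. WY \<omega> * (indicator (B j) (Y j \<omega>) * cos (V' \<omega>)) \<partial>N)"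
        using 1 3 M3 M4 by (simp add: algebra_simps)
      have S: "(\<integral>\<omega>. WX \<omega> * (indicator (B j) (X j \<omega>) * sin (V \<omega>)) \<partial>M)
          = (\<integral>\<omega>. WY \<omega> * (indicator (B j) (Y j \<omega>) * sin (V' \<omega>)) \<partial>N)"
        using 2 3 M3 M4 by (simp add: algebra_simps)
      have "?C (insert j J) a \<and> ?S (insert j J) a"
        using C S insert.hyps by (simp add: WX_def WY_def V_def V'_def mult_ac)
    }
    then show ?case by blast
  qed
  then show "?C J a" "?S J a" by auto
qed

text \<open>The case \<open>J = I\<close> of the preceding lemma: the remaining sum is empty and its
  cosine is 1.\<close>

lemma measure_rectangle_eq:
  fixes X :: "'i \<Rightarrow> 'a \<Rightarrow> real" and Y :: "'i \<Rightarrow> 'b \<Rightarrow> real"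
  assumes "finite_measure M" "finite_measure N" and "finite I"
    and [measurable]: "\<And>i. i \<in> I \<Longrightarrow> X i \<in> borel_measurable M" "\<And>i. i \<in> I \<Longrightarrow> Y i \<in> borel_measurable N"
    and c: "\<And>a. (\<integral>\<omega>. cos (\<Sum>i\<in>I. a i * X i \<omega>) \<partial>M) = (\<integral>\<omega>. cos (\<Sum>i\<in>I. a i * Y i \<omega>) \<partial>N)"
    and s: "\<And>a. (\<integral>\<omega>. sin (\<Sum>i\<in>I. a i * X i \<omega>) \<partial>M) = (\<integral>\<omega>. sin (\<Sum>i\<in>I. a i * Y i \<omega>) \<partial>N)"
    and B: "\<And>i. i \<in> I \<Longrightarrow> B i \<in> sets borel"
  shows "measure M {\<omega> \<in> space M. \<forall>i\<in>I. X i \<omega> \<in> B i} = measure N {\<omega> \<in> space N. \<forall>i\<in>I. Y i \<omega> \<in> B i}"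
proof -
  have [measurable]: "\<And>i. i \<in> I \<Longrightarrow> B i \<in> sets borel" by fact
  have "(\<integral>\<omega>. (\<Prod>i\<in>I. indicator (B i) (X i \<omega>)) \<partial>M) = (\<integral>\<omega>. (\<Prod>i\<in>I. indicator (B i) (Y i \<omega>)) \<partial>N :: real)"
    using rectangle_trig_eq(1)[OF assms \<open>finite I\<close> order_refl] by simp
  moreover have "(\<Prod>i\<in>I. indicator (B i) (x i)) = (indicator {x. \<forall>i\<in>I. x i \<in> B i} x :: real)" for x
    using \<open>finite I\<close> by (induction I rule: finite_induct) (auto simp: indicator_def)
  moreover have "(\<integral>\<omega>. indicator {x. \<forall>i\<in>I. x i \<in> B i} (\<lambda>i. X i \<omega>) \<partial>M) = (\<integral>\<omega>. indicator {\<omega> \<in> space M. \<forall>i\<in>I. X i \<omega> \<in> B i} \<omega> \<partial>M :: real)"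
    by (intro Bochner_Integration.integral_cong) (auto split: split_indicator)
  moreover have "(\<integral>\<omega>. indicator {x. \<forall>i\<in>I. x i \<in> B i} (\<lambda>i. Y i \<omega>) \<partial>N) = (\<integral>\<omega>. indicator {\<omega> \<in> space N. \<forall>i\<in>I. Y i \<omega> \<in> B i} \<omega> \<partial>N :: real)"
    by (intro Bochner_Integration.integral_cong) (auto split: split_indicator)
  moreover have "{\<omega> \<in> space M. \<forall>i\<in>I. X i \<omega> \<in> B i} \<inter> space M = {\<omega> \<in> space M. \<forall>i\<in>I. X i \<omega> \<in> B i}"
    "{\<omega> \<in> space N. \<forall>i\<in>I. Y i \<omega> \<in> B i} \<inter> space N = {\<omega> \<in> space N. \<forall>i\<in>I. Y i \<omega> \<in> B i}"
    by auto
  ultimately show ?thesis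
    by simp
qed

text \<open>Rectangles are closed under intersection and generate the product sigma-algebra. Time
  reversal applies a nonlinear functional to a whole vector, so equality on rectangles alone would
  not do.\<close>

lemma distr_PiM_eqI:
  fixes X :: "'i \<Rightarrow> 'a \<Rightarrow> real" and Y :: "'i \<Rightarrow> 'b \<Rightarrow> real"
  assumes M: "prob_space M" and N: "prob_space N" and I: "finite I"
    and X[measurable]: "\<And>i. i \<in> I \<Longrightarrow> X i \<in> borel_measurable M" and Y[measurable]: "\<And>i. i \<in> I \<Longrightarrow> Y i \<in> borel_measurable N"
    and c: "\<And>a. (\<integral>\<omega>. cos (\<Sum>i\<in>I. a i * X i \<omega>) \<partial>M) = (\<integral>\<omega>. cos (\<Sum>i\<in>I. a i * Y i \<omega>) \<partial>N)"
    and s: "\<And>a. (\<integral>\<omega>. sin (\<Sum>i\<in>I. a i * X i \<omega>) \<partial>M) = (\<integral>\<omega>. sin (\<Sum>i\<in>I. a i * Y i \<omega>) \<partial>N)"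
  shows "distr M (PiM I (\<lambda>_. borel)) (\<lambda>\<omega>. \<lambda>i\<in>I. X i \<omega>) = distr N (PiM I (\<lambda>_. borel)) (\<lambda>\<omega>. \<lambda>i\<in>I. Y i \<omega>)"
proof -
  interpret M: prob_space M by fact
  interpret N: prob_space N by fact
  have mX[measurable]: "(\<lambda>\<omega>. \<lambda>i\<in>I. X i \<omega>) \<in> measurable M (PiM I (\<lambda>_. borel))"
    and mY[measurable]: "(\<lambda>\<omega>. \<lambda>i\<in>I. Y i \<omega>) \<in> measurable N (PiM I (\<lambda>_. borel))"
    by measurable
  interpret DX: prob_space "distr M (PiM I (\<lambda>_. borel)) (\<lambda>\<omega>. \<lambda>i\<in>I. X i \<omega>)" by (rule M.prob_space_distr) simp
  interpret DY: prob_space "distr N (PiM I (\<lambda>_. borel)) (\<lambda>\<omega>. \<lambda>i\<in>I. Y i \<omega>)" by (rule N.prob_space_distr) simp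
  show ?thesis
  proof (rule measure_eqI_PiM_finite[OF I, where A="\<lambda>_. space (PiM I (\<lambda>_. borel))"])
    fix A :: "'i \<Rightarrow> real set" assume A: "\<And>i. i \<in> I \<Longrightarrow> A i \<in> sets borel"
    have "measure M {\<omega> \<in> space M. \<forall>i\<in>I. X i \<omega> \<in> A i} = measure N {\<omega> \<in> space N. \<forall>i\<in>I. Y i \<omega> \<in> A i}"
      by (rule measure_rectangle_eq) (use assms A M.finite_measure_axioms N.finite_measure_axioms in auto)
    moreover have "(\<lambda>\<omega>. \<lambda>i\<in>I. X i \<omega>) -` Pi\<^sub>E I A \<inter> space M = {\<omega> \<in> space M. \<forall>i\<in>I. X i \<omega> \<in> A i}"
      "(\<lambda>\<omega>. \<lambda>i\<in>I. Y i \<omega>) -` Pi\<^sub>E I A \<inter> space N = {\<omega> \<in> space N. \<forall>i\<in>I. Y i \<omega> \<in> A i}"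
      by auto
    moreover have "Pi\<^sub>E I A \<in> sets (PiM I (\<lambda>_. borel))" using A I by (intro sets_PiM_I_finite) auto
    ultimately show "emeasure (distr M (PiM I (\<lambda>_. borel)) (\<lambda>\<omega>. \<lambda>i\<in>I. X i \<omega>)) (Pi\<^sub>E I A)
      = emeasure (distr N (PiM I (\<lambda>_. borel)) (\<lambda>\<omega>. \<lambda>i\<in>I. Y i \<omega>)) (Pi\<^sub>E I A)"
      by (simp add: emeasure_distr M.emeasure_eq_measure N.emeasure_eq_measure)
  next
    show "range (\<lambda>_::nat. space (PiM I (\<lambda>_. borel))) \<subseteq> prod_algebra I (\<lambda>_. borel)"
      using I by (auto simp: space_PiM intro!: prod_algebraI_finite)
    show "emeasure (distr M (Pi\<^sub>M I (\<lambda>_. borel)) (\<lambda>\<omega>. \<lambda>i\<in>I. X i \<omega>)) (space (Pi\<^sub>M I (\<lambda>_. borel))) \<noteq> \<infinity>"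
      using DX.emeasure_space_1 by simp
  qed (simp_all add: space_PiM)
qed

section \<open>One-dimensional Gaussian variables\<close>

lemma std_normal_trig:
  shows "(\<integral>x. std_normal_density x * cos (t * x) \<partial>lborel) = exp (- t\<^sup>2 / 2)"
    and "(\<integral>x. std_normal_density x * sin (t * x) \<partial>lborel) = 0"
proof -
  interpret real_distribution std_normal_distribution by (rule real_dist_normal_dist)
  have i: "integrable std_normal_distribution (\<lambda>x. iexp (t * x))"
    using integrable_iexp[of "\<lambda>x. t * x"] by simp
  have c: "(\<integral>x. iexp (t * x) \<partial>std_normal_distribution) = complex_of_real (exp (- t\<^sup>2 / 2))"
    using fun_cong[OF char_std_normal_distribution, of t] by (simp add: char_def)
  show "(\<integral>x. std_normal_density x * cos (t * x) \<partial>lborel) = exp (- t\<^sup>2 / 2)"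
    using integral_Re[OF i] c by (simp add: Re_exp integral_density)
  show "(\<integral>x. std_normal_density x * sin (t * x) \<partial>lborel) = 0"
    using integral_Im[OF i] c by (simp add: Im_exp integral_density)
qed

lemma normal_trig:
  assumes "\<sigma> > 0"
  shows "(\<integral>x. normal_density \<mu> \<sigma> x * cos (b * x) \<partial>lborel) = cos (b * \<mu>) * exp (- (b * \<sigma>)\<^sup>2 / 2)"
    and "(\<integral>x. normal_density \<mu> \<sigma> x * sin (b * x) \<partial>lborel) = sin (b * \<mu>) * exp (- (b * \<sigma>)\<^sup>2 / 2)"
proof -
  have nd: "\<sigma> * normal_density \<mu> \<sigma> (\<mu> + \<sigma> * x) = std_normal_density x" for x
    using assms by (simp add: normal_density_def real_sqrt_mult power_mult_distrib)
  have i: "integrable lborel (\<lambda>x. std_normal_density x * cos (b * \<sigma> * x))"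
    "integrable lborel (\<lambda>x. std_normal_density x * sin (b * \<sigma> * x))"
    by (rule Bochner_Integration.integrable_bound[OF integrable_normal_density[of 1 0]]; auto simp: abs_mult mult_left_le)+
  have "(\<integral>x. normal_density \<mu> \<sigma> x * cos (b * x) \<partial>lborel) = (\<integral>x. \<sigma> * normal_density \<mu> \<sigma> (\<mu> + \<sigma> * x) * cos (b * (\<mu> + \<sigma> * x)) \<partial>lborel)"
    using assms by (subst lborel_integral_real_affine[where c=\<sigma> and t=\<mu>]) (auto simp: mult.assoc)
  also have "\<dots> = (\<integral>x. cos (b * \<mu>) * (std_normal_density x * cos (b * \<sigma> * x)) - sin (b * \<mu>) * (std_normal_density x * sin (b * \<sigma> * x)) \<partial>lborel)"
    unfolding nd by (simp add: cos_add algebra_simps)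
  finally show "(\<integral>x. normal_density \<mu> \<sigma> x * cos (b * x) \<partial>lborel) = cos (b * \<mu>) * exp (- (b * \<sigma>)\<^sup>2 / 2)"
    using i by (simp add: std_normal_trig)
  have "(\<integral>x. normal_density \<mu> \<sigma> x * sin (b * x) \<partial>lborel) = (\<integral>x. \<sigma> * normal_density \<mu> \<sigma> (\<mu> + \<sigma> * x) * sin (b * (\<mu> + \<sigma> * x)) \<partial>lborel)"
    using assms by (subst lborel_integral_real_affine[where c=\<sigma> and t=\<mu>]) (auto simp: mult.assoc)
  also have "\<dots> = (\<integral>x. sin (b * \<mu>) * (std_normal_density x * cos (b * \<sigma> * x)) + cos (b * \<mu>) * (std_normal_density x * sin (b * \<sigma> * x)) \<partial>lborel)"
    unfolding nd by (simp add: sin_add algebra_simps)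
  finally show "(\<integral>x. normal_density \<mu> \<sigma> x * sin (b * x) \<partial>lborel) = sin (b * \<mu>) * exp (- (b * \<sigma>)\<^sup>2 / 2)"
    using i by (simp add: std_normal_trig)
qed

text \<open>Completing the square: an exponential weight moves the mean by \<open>l\<close> times
  the variance. This is the one-dimensional Cameron-Martin formula.\<close>

lemma normal_density_tilt:
  assumes "\<sigma> > 0"
  shows "normal_density 0 \<sigma> x * exp (l * x) = exp (l\<^sup>2 * \<sigma>\<^sup>2 / 2) * normal_density (l * \<sigma>\<^sup>2) \<sigma> x"
proof -
  have "- x\<^sup>2 / (2 * \<sigma>\<^sup>2) + l * x = l\<^sup>2 * \<sigma>\<^sup>2 / 2 + - (x - l * \<sigma>\<^sup>2)\<^sup>2 / (2 * \<sigma>\<^sup>2)"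
    using assms by (simp add: field_simps power2_eq_square)
  then show ?thesis unfolding normal_density_def
    by (simp add: exp_add[symmetric] del: exp_add)
qed

text \<open>All formulas are in terms of the variance \<open>v\<close>, so that they cover the
  degenerate case \<open>v = 0\<close>. In the tilted ones the weight
  \<open>exp (l * Y \<omega>)\<close> moves the mean to \<open>l * v\<close>, which appears as the
  phase \<open>b * l * v\<close>, and contributes the mass
  \<open>exp (l\<^sup>2 * v / 2)\<close>.\<close>

lemma (in prob_space) centered_gaussian:
  assumes g: "gaussian_rv M Y" and z: "expectation Y = 0" and v: "expectation (\<lambda>\<omega>. (Y \<omega>)\<^sup>2) = v"
  shows centered_gaussian_meas: "Y \<in> borel_measurable M"
    and centered_gaussian_integrable_square: "integrable M (\<lambda>\<omega>. (Y \<omega>)\<^sup>2)"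
    and centered_gaussian_integrable_exp: "integrable M (\<lambda>\<omega>. exp (l * Y \<omega>))"
    and centered_gaussian_tilted_cos: "expectation (\<lambda>\<omega>. exp (l * Y \<omega>) * cos (b * Y \<omega>)) = exp ((l\<^sup>2 - b\<^sup>2) * v / 2) * cos (b * l * v)"
    and centered_gaussian_tilted_sin: "expectation (\<lambda>\<omega>. exp (l * Y \<omega>) * sin (b * Y \<omega>)) = exp ((l\<^sup>2 - b\<^sup>2) * v / 2) * sin (b * l * v)"
    and centered_gaussian_abs: "expectation (\<lambda>\<omega>. \<bar>Y \<omega>\<bar>) = sqrt (2 / pi) * sqrt v"
proof -
  show Y[measurable]: "Y \<in> borel_measurable M" using g by (simp add: gaussian_rv_def)
  consider (const) \<mu> where "AE \<omega> in M. Y \<omega> = \<mu>" | (normal) \<mu> \<sigma> where "\<sigma> > 0" "distributed M lborel Y (normal_density \<mu> \<sigma>)"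
    using g by (auto simp: gaussian_rv_def)
  then have "integrable M (\<lambda>\<omega>. (Y \<omega>)\<^sup>2) \<and> integrable M (\<lambda>\<omega>. exp (l * Y \<omega>)) \<and>
    expectation (\<lambda>\<omega>. exp (l * Y \<omega>) * cos (b * Y \<omega>)) = exp ((l\<^sup>2 - b\<^sup>2) * v / 2) * cos (b * l * v) \<and>
    expectation (\<lambda>\<omega>. exp (l * Y \<omega>) * sin (b * Y \<omega>)) = exp ((l\<^sup>2 - b\<^sup>2) * v / 2) * sin (b * l * v) \<and>
    expectation (\<lambda>\<omega>. \<bar>Y \<omega>\<bar>) = sqrt (2 / pi) * sqrt v"
  proof cases
    case const
    have "expectation Y = expectation (\<lambda>_. \<mu>)" using const by (intro integral_cong_AE) auto
    then have "\<mu> = 0" using z by (simp add: prob_space)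
    then have Y0: "AE \<omega> in M. Y \<omega> = 0" using const by simp
    have "expectation (\<lambda>\<omega>. (Y \<omega>)\<^sup>2) = expectation (\<lambda>_. 0)" using Y0 by (intro integral_cong_AE) auto
    then have v0: "v = 0" using v by simp
    have "integrable M (\<lambda>\<omega>. (Y \<omega>)\<^sup>2) = integrable M (\<lambda>_. 0 :: real)" using Y0 by (intro integrable_cong_AE) auto
    moreover have "integrable M (\<lambda>\<omega>. exp (l * Y \<omega>)) = integrable M (\<lambda>_. 1 :: real)" using Y0 by (intro integrable_cong_AE) auto
    moreover have "expectation (\<lambda>\<omega>. exp (l * Y \<omega>) * cos (b * Y \<omega>)) = expectation (\<lambda>_. 1)" using Y0 by (intro integral_cong_AE) auto
    moreover have "expectation (\<lambda>\<omega>. exp (l * Y \<omega>) * sin (b * Y \<omega>)) = expectation (\<lambda>_. 0)" using Y0 by (intro integral_cong_AE) auto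
    moreover have "expectation (\<lambda>\<omega>. \<bar>Y \<omega>\<bar>) = expectation (\<lambda>_. 0)" using Y0 by (intro integral_cong_AE) auto
    ultimately show ?thesis by (simp add: v0 prob_space)
  next
    case normal
    have "\<mu> = 0" using normal_distributed_expectation[OF normal] z by simp
    then have d: "distributed M lborel Y (normal_density 0 \<sigma>)" using normal by simp
    have "v = \<sigma>\<^sup>2" using normal_distributed_variance[OF normal] z v by simp
    note di = distributed_integral[OF d, symmetric] distributed_integrable[OF d]
    have sq: "integrable lborel (\<lambda>x. normal_density 0 \<sigma> x * x\<^sup>2)" using integrable_normal_moment[OF normal(1), of 0 2] by simp
    have ex: "integrable lborel (\<lambda>x. normal_density 0 \<sigma> x * exp (l * x))"
      unfolding normal_density_tilt[OF normal(1)] using normal(1) by simp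
    have ab: "(\<integral>x. normal_density 0 \<sigma> x * \<bar>x\<bar> \<partial>lborel) = sqrt (2 / pi) * \<sigma>"
      using integral_normal_moment_abs_odd[OF normal(1), of 0 0] by simp
    have 1: "integrable M (\<lambda>\<omega>. (Y \<omega>)\<^sup>2)" using sq by (subst (asm) distributed_integrable[OF d]) auto
    have 2: "integrable M (\<lambda>\<omega>. exp (l * Y \<omega>))" using ex by (subst (asm) distributed_integrable[OF d]) auto
    have 3: "expectation (\<lambda>\<omega>. \<bar>Y \<omega>\<bar>) = sqrt (2 / pi) * \<sigma>"
      unfolding ab[symmetric] by (subst distributed_integral[OF d]) auto
    have 4: "expectation (\<lambda>\<omega>. exp (l * Y \<omega>) * cos (b * Y \<omega>)) = (\<integral>x. exp (l\<^sup>2 * \<sigma>\<^sup>2 / 2) * (normal_density (l * \<sigma>\<^sup>2) \<sigma> x * cos (b * x)) \<partial>lborel)"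
      by (subst distributed_integral[OF d, symmetric]) (auto simp: mult.assoc[symmetric] normal_density_tilt[OF normal(1)])
    have 5: "expectation (\<lambda>\<omega>. exp (l * Y \<omega>) * sin (b * Y \<omega>)) = (\<integral>x. exp (l\<^sup>2 * \<sigma>\<^sup>2 / 2) * (normal_density (l * \<sigma>\<^sup>2) \<sigma> x * sin (b * x)) \<partial>lborel)"
      by (subst distributed_integral[OF d, symmetric]) (auto simp: mult.assoc[symmetric] normal_density_tilt[OF normal(1)])
    have 6: "exp (l\<^sup>2 * \<sigma>\<^sup>2 / 2) * exp (- (b * \<sigma>)\<^sup>2 / 2) = exp ((l\<^sup>2 - b\<^sup>2) * v / 2)"
      unfolding exp_add[symmetric] \<open>v = \<sigma>\<^sup>2\<close> by (simp add: field_simps power_mult_distrib)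
    show ?thesis
      using 1 2 3 4[unfolded integral_mult_right_zero normal_trig[OF normal(1)]]
        5[unfolded integral_mult_right_zero normal_trig[OF normal(1)]] 6 normal(1)
      by (simp add: \<open>v = \<sigma>\<^sup>2\<close> mult_ac)
  qed
  then show "integrable M (\<lambda>\<omega>. (Y \<omega>)\<^sup>2)" "integrable M (\<lambda>\<omega>. exp (l * Y \<omega>))"
    "expectation (\<lambda>\<omega>. exp (l * Y \<omega>) * cos (b * Y \<omega>)) = exp ((l\<^sup>2 - b\<^sup>2) * v / 2) * cos (b * l * v)"
    "expectation (\<lambda>\<omega>. exp (l * Y \<omega>) * sin (b * Y \<omega>)) = exp ((l\<^sup>2 - b\<^sup>2) * v / 2) * sin (b * l * v)"
    "expectation (\<lambda>\<omega>. \<bar>Y \<omega>\<bar>) = sqrt (2 / pi) * sqrt v"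
    by auto
qed

lemma (in prob_space) centered_gaussian_exp:
  assumes g: "gaussian_rv M Y" and z: "expectation Y = 0" and v: "expectation (\<lambda>\<omega>. (Y \<omega>)\<^sup>2) = v"
  shows "expectation (\<lambda>\<omega>. exp (l * Y \<omega>)) = exp (l\<^sup>2 * v / 2)"
  using centered_gaussian_tilted_cos[OF assms, of l 0] by simp

lemma (in prob_space) centered_gaussian_trig:
  assumes g: "gaussian_rv M Y" and z: "expectation Y = 0" and v: "expectation (\<lambda>\<omega>. (Y \<omega>)\<^sup>2) = v"
  shows "expectation (\<lambda>\<omega>. cos (Y \<omega>)) = exp (- v / 2)" "expectation (\<lambda>\<omega>. sin (Y \<omega>)) = 0"
  using centered_gaussian_tilted_cos[OF assms, of 0 1] centered_gaussian_tilted_sin[OF assms, of 0 1] by simp_all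

text \<open>Exponential Markov inequality with parameter \<open>1 / s\<close> or
  \<open>- 1 / s\<close>, where the exponential moment is at most
  \<open>exp (1 / 2) \<le> 2\<close>. The decay is weaker than Gaussian, but enough because
  \<open>y\<close> will be at least of order \<open>ln n\<close>.\<close>

lemma (in prob_space) centered_gaussian_tail:
  assumes g: "gaussian_rv M Y" and z: "expectation Y = 0" and v: "expectation (\<lambda>\<omega>. (Y \<omega>)\<^sup>2) = v"
    and "v \<le> s\<^sup>2" "s > 0"
  shows "prob {\<omega> \<in> space M. Y \<omega> \<ge> s * y} \<le> 2 * exp (- y)"
    and "prob {\<omega> \<in> space M. Y \<omega> \<le> - (s * y)} \<le> 2 * exp (- y)"
    and "prob {\<omega> \<in> space M. \<bar>Y \<omega>\<bar> \<ge> s * y} \<le> 4 * exp (- y)"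
proof -
  note [measurable] = centered_gaussian_meas[OF g z v]
  have e2: "exp (1 / 2) \<le> (2::real)"
  proof (rule power2_le_imp_le)
    have "exp (1 / 2) ^ 2 = exp (1::real)" by (subst exp_double[symmetric]) simp
    then show "exp (1 / 2) ^ 2 \<le> (2::real)\<^sup>2" using exp_le by (simp only: power2_eq_square)
  qed simp
  have e: "expectation (\<lambda>\<omega>. exp (l * Y \<omega>)) \<le> 2" if "l\<^sup>2 = 1 / s\<^sup>2" for l
  proof -
    have "v / s\<^sup>2 \<le> 1" using assms(4,5) by (simp add: divide_le_eq_1)
    then have "l\<^sup>2 * v / 2 \<le> 1 / 2" using that by simp
    then have "exp (l\<^sup>2 * v / 2) \<le> exp (1 / 2)" by (simp only: exp_le_cancel_iff)
    from order_trans[OF this e2] show ?thesis by (simp only: centered_gaussian_exp[OF g z v])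
  qed
  have tail: "prob {\<omega> \<in> space M. exp (l * Y \<omega>) \<ge> exp y} \<le> 2 * exp (- y)" if "l\<^sup>2 = 1 / s\<^sup>2" for l
  proof -
    have "prob {\<omega> \<in> space M. exp (l * Y \<omega>) \<ge> exp y} \<le> expectation (\<lambda>\<omega>. exp (l * Y \<omega>)) / exp y"
      by (rule integral_Markov_inequality_measure[where A="{}"]) (auto intro: centered_gaussian_integrable_exp[OF g z v])
    also have "\<dots> \<le> 2 / exp y" using e[OF that] by (intro divide_right_mono) auto
    finally show ?thesis by (simp add: exp_minus divide_inverse)
  qed
  have eq: "{\<omega> \<in> space M. exp ((1 / s) * Y \<omega>) \<ge> exp y} = {\<omega> \<in> space M. Y \<omega> \<ge> s * y}"
    "{\<omega> \<in> space M. exp ((- 1 / s) * Y \<omega>) \<ge> exp y} = {\<omega> \<in> space M. Y \<omega> \<le> - (s * y)}"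
  proof -
    have "(exp y \<le> exp ((1 / s) * x)) = (s * y \<le> x)" "(exp y \<le> exp ((- 1 / s) * x)) = (x \<le> - (s * y))" for x
      unfolding exp_le_cancel_iff using \<open>s > 0\<close> by (auto simp: pos_le_divide_eq pos_le_minus_divide_eq mult.commute)
    then show "{\<omega> \<in> space M. exp ((1 / s) * Y \<omega>) \<ge> exp y} = {\<omega> \<in> space M. Y \<omega> \<ge> s * y}"
      "{\<omega> \<in> space M. exp ((- 1 / s) * Y \<omega>) \<ge> exp y} = {\<omega> \<in> space M. Y \<omega> \<le> - (s * y)}"
      by (simp_all only:)
  qed
  show 1: "prob {\<omega> \<in> space M. Y \<omega> \<ge> s * y} \<le> 2 * exp (- y)"
    using tail[of "1 / s"] unfolding eq by (simp add: power_divide)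
  show 2: "prob {\<omega> \<in> space M. Y \<omega> \<le> - (s * y)} \<le> 2 * exp (- y)"
    using tail[of "- 1 / s"] unfolding eq by (simp add: power_divide)
  have "prob {\<omega> \<in> space M. \<bar>Y \<omega>\<bar> \<ge> s * y} \<le> prob ({\<omega> \<in> space M. Y \<omega> \<ge> s * y} \<union> {\<omega> \<in> space M. Y \<omega> \<le> - (s * y)})"
    by (intro finite_measure_mono) auto
  also have "\<dots> \<le> prob {\<omega> \<in> space M. Y \<omega> \<ge> s * y} + prob {\<omega> \<in> space M. Y \<omega> \<le> - (s * y)}"
    by (intro measure_Un_le) auto
  finally show "prob {\<omega> \<in> space M. \<bar>Y \<omega>\<bar> \<ge> s * y} \<le> 4 * exp (- y)"
    using 1 2 by simp
qed

section \<open>Gaussian processes\<close>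

text \<open>The index type is left open: combinations of the process are treated as processes again,
  indexed by \<open>unit\<close> for a single combination, by \<open>bool\<close> for a pair and by
  \<open>nat\<close> for the walk.\<close>

locale centered_gaussian_process = prob_space M
  for M :: "'a measure" and T :: "'i set" and X :: "'i \<Rightarrow> 'a \<Rightarrow> real" and K :: "'i \<Rightarrow> 'i \<Rightarrow> real" +
  assumes gaussian: "gaussian_process M T X"
    and centered: "centered_process M T X"
    and cov: "s \<in> T \<Longrightarrow> t \<in> T \<Longrightarrow> expectation (\<lambda>\<omega>. X s \<omega> * X t \<omega>) = K s t"
begin

lemma gaussian_sum: "finite S \<Longrightarrow> S \<subseteq> T \<Longrightarrow> gaussian_rv M (\<lambda>\<omega>. \<Sum>t\<in>S. a t * X t \<omega>)"
  using gaussian by (auto simp: gaussian_process_def)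

lemma
  assumes "t \<in> T"
  shows gaussian_rv: "gaussian_rv M (X t)" and expectation_zero: "expectation (X t) = 0"
    and variance: "expectation (\<lambda>\<omega>. (X t \<omega>)\<^sup>2) = K t t"
  using gaussian_sum[of "{t}" "\<lambda>_. 1"] centered cov[of t t] assms by (auto simp: centered_process_def power2_eq_square)

lemmas marginal = gaussian_rv expectation_zero variance

lemma
  assumes "t \<in> T"
  shows measurable_process: "X t \<in> borel_measurable M" and square_integrable: "integrable M (\<lambda>\<omega>. (X t \<omega>)\<^sup>2)"
  using centered_gaussian_meas[OF marginal[OF assms]] centered_gaussian_integrable_square[OF marginal[OF assms]] by auto

lemma integrable_mult:
  assumes "s \<in> T" "t \<in> T"
  shows "integrable M (\<lambda>\<omega>. X s \<omega> * X t \<omega>)"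
proof (rule Bochner_Integration.integrable_bound)
  show "integrable M (\<lambda>\<omega>. (X s \<omega>)\<^sup>2 + (X t \<omega>)\<^sup>2)" using square_integrable assms by auto
  show "(\<lambda>\<omega>. X s \<omega> * X t \<omega>) \<in> borel_measurable M" using measurable_process assms by simp
  have "\<bar>x * y\<bar> \<le> x\<^sup>2 + y\<^sup>2" for x y :: real
  proof -
    have "2 * (\<bar>x\<bar> * \<bar>y\<bar>) \<le> x\<^sup>2 + y\<^sup>2" using sum_squares_bound[of "\<bar>x\<bar>" "\<bar>y\<bar>"] by (simp add: mult.assoc)
    moreover have "0 \<le> \<bar>x\<bar> * \<bar>y\<bar>" by simp
    ultimately show ?thesis unfolding abs_mult by linarith
  qed
  then show "AE \<omega> in M. norm (X s \<omega> * X t \<omega>) \<le> norm ((X s \<omega>)\<^sup>2 + (X t \<omega>)\<^sup>2)" by simp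
qed

lemma integrable_process: "t \<in> T \<Longrightarrow> integrable M (X t)"
  using square_integrable_imp_integrable[OF measurable_process square_integrable] .

lemma linear_image:
  fixes b :: "'k \<Rightarrow> 'i \<Rightarrow> real"
  assumes "finite S" "S \<subseteq> T"
  shows "centered_gaussian_process M I (\<lambda>k \<omega>. \<Sum>t\<in>S. b k t * X t \<omega>) (\<lambda>j k. \<Sum>s\<in>S. \<Sum>t\<in>S. b j s * b k t * K s t)"
proof
  show "gaussian_process M I (\<lambda>k \<omega>. \<Sum>t\<in>S. b k t * X t \<omega>)"
    unfolding gaussian_process_def
  proof safe
    fix J :: "'k set" and a :: "'k \<Rightarrow> real" assume "finite J"
    have "(\<Sum>k\<in>J. a k * (\<Sum>t\<in>S. b k t * X t \<omega>)) = (\<Sum>t\<in>S. (\<Sum>k\<in>J. a k * b k t) * X t \<omega>)" for \<omega>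
      unfolding sum_distrib_left sum_distrib_right by (subst sum.swap) (simp add: mult.assoc)
    then show "gaussian_rv M (\<lambda>\<omega>. \<Sum>k\<in>J. a k * (\<Sum>t\<in>S. b k t * X t \<omega>))"
      using gaussian_sum[OF assms] by simp
  qed
  show "centered_process M I (\<lambda>k \<omega>. \<Sum>t\<in>S. b k t * X t \<omega>)"
    unfolding centered_process_def
    using assms expectation_zero integrable_process by (auto simp: subset_iff)
  show "expectation (\<lambda>\<omega>. (\<Sum>t\<in>S. b j t * X t \<omega>) * (\<Sum>t\<in>S. b k t * X t \<omega>)) = (\<Sum>s\<in>S. \<Sum>t\<in>S. b j s * b k t * K s t)" for j k
  proof -
    have "(\<Sum>t\<in>S. b j t * X t \<omega>) * (\<Sum>t\<in>S. b k t * X t \<omega>) = (\<Sum>s\<in>S. \<Sum>t\<in>S. b j s * b k t * (X s \<omega> * X t \<omega>))" for \<omega>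
      by (simp add: sum_product mult_ac)
    then show ?thesis
      using assms integrable_mult by (simp add: subset_iff cov)
  qed
qed

lemma
  assumes S: "finite S" "S \<subseteq> T"
  shows expectation_cos_sum: "expectation (\<lambda>\<omega>. cos (\<Sum>t\<in>S. a t * X t \<omega>)) = exp (- (\<Sum>s\<in>S. \<Sum>t\<in>S. a s * a t * K s t) / 2)"
    and expectation_sin_sum: "expectation (\<lambda>\<omega>. sin (\<Sum>t\<in>S. a t * X t \<omega>)) = 0"
proof -
  interpret L: centered_gaussian_process M "UNIV :: unit set" "\<lambda>k \<omega>. \<Sum>t\<in>S. a t * X t \<omega>" "\<lambda>j k. \<Sum>s\<in>S. \<Sum>t\<in>S. a s * a t * K s t"
    using linear_image[OF S, of UNIV "\<lambda>_::unit. a"] .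
  show "expectation (\<lambda>\<omega>. cos (\<Sum>t\<in>S. a t * X t \<omega>)) = exp (- (\<Sum>s\<in>S. \<Sum>t\<in>S. a s * a t * K s t) / 2)"
    "expectation (\<lambda>\<omega>. sin (\<Sum>t\<in>S. a t * X t \<omega>)) = 0"
    using centered_gaussian_trig[OF L.marginal] by auto
qed

end

lemma centered_gaussian_process_law_eq:
  assumes X: "centered_gaussian_process M T X K" and Y: "centered_gaussian_process N T' Y K'"
    and I: "finite I" "I \<subseteq> T" "I \<subseteq> T'" "\<And>s t. s \<in> I \<Longrightarrow> t \<in> I \<Longrightarrow> K s t = K' s t"
  shows "distr M (PiM I (\<lambda>_. borel)) (\<lambda>\<omega>. \<lambda>i\<in>I. X i \<omega>) = distr N (PiM I (\<lambda>_. borel)) (\<lambda>\<omega>. \<lambda>i\<in>I. Y i \<omega>)"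
proof -
  interpret X: centered_gaussian_process M T X K by fact
  interpret Y: centered_gaussian_process N T' Y K' by fact
  show ?thesis
    by (rule distr_PiM_eqI)
      (use I X.measurable_process Y.measurable_process in
        \<open>auto simp: X.expectation_cos_sum Y.expectation_cos_sum X.expectation_sin_sum Y.expectation_sin_sum X.prob_space_axioms Y.prob_space_axioms\<close>)
qed

section \<open>Independence of uncorrelated coordinates\<close>

context centered_gaussian_process
begin

text \<open>The pair is compared with the independent copies \<open>X i (fst p)\<close> and
  \<open>X j (snd p)\<close> on the product space. Both have the same trigonometric means, because
  the mixed term of the variance vanishes, and hence give rectangles the same probability.\<close>

lemma uncorrelated_indep:
  assumes "i \<in> T" "j \<in> T" "i \<noteq> j" "K i j = 0"
  shows "indep_var borel (X i) borel (X j)"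
proof -
  note [measurable] = measurable_process[OF \<open>i \<in> T\<close>] measurable_process[OF \<open>j \<in> T\<close>]
  interpret P: pair_prob_space M M ..
  let ?Y = "\<lambda>k p. if k = i then X i (fst p) else X j (snd p)"
  have K: "K j i = 0" using assms cov[of i j] cov[of j i] by (simp add: mult.commute)
  have var: "(\<Sum>s\<in>{i,j}. \<Sum>t\<in>{i,j}. a s * a t * K s t) = a i * a i * K i i + a j * a j * K j j" for a
    using assms K by simp
  have sum: "(\<Sum>k\<in>{i,j}. a k * ?Y k p) = a i * X i (fst p) + a j * X j (snd p)" for a p
    using assms by simp
  have ci: "expectation (\<lambda>\<omega>. cos (a * X i \<omega>)) = exp (- a\<^sup>2 * K i i / 2)" "expectation (\<lambda>\<omega>. sin (a * X i \<omega>)) = 0" for a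
    using expectation_cos_sum[of "{i}" "\<lambda>_. a"] expectation_sin_sum[of "{i}" "\<lambda>_. a"] assms by (auto simp: power2_eq_square)
  have cj: "expectation (\<lambda>\<omega>. cos (a * X j \<omega>)) = exp (- a\<^sup>2 * K j j / 2)" "expectation (\<lambda>\<omega>. sin (a * X j \<omega>)) = 0" for a
    using expectation_cos_sum[of "{j}" "\<lambda>_. a"] expectation_sin_sum[of "{j}" "\<lambda>_. a"] assms by (auto simp: power2_eq_square)
  have ic: "integrable M (\<lambda>\<omega>. cos (a * X k \<omega>))" "integrable M (\<lambda>\<omega>. sin (a * X k \<omega>))" if "k \<in> T" for a k
    using measurable_process[OF that] by (auto intro!: integrable_const_bound[of _ 1])
  have cosP: "(\<integral>p. cos (a i * X i (fst p) + a j * X j (snd p)) \<partial>(M \<Otimes>\<^sub>M M)) = exp (- (a i * a i * K i i + a j * a j * K j j) / 2)" for a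
  proof -
    have "(\<integral>p. cos (a i * X i (fst p) + a j * X j (snd p)) \<partial>(M \<Otimes>\<^sub>M M))
       = (\<integral>x. (\<integral>y. cos (a i * X i x) * cos (a j * X j y) - sin (a i * X i x) * sin (a j * X j y) \<partial>M) \<partial>M)"
      by (subst P.integral_fst'[symmetric]) (auto intro!: P.P.integrable_const_bound[of _ 1] simp flip: cos_add)
    also have "\<dots> = exp (- (a i)\<^sup>2 * K i i / 2) * exp (- (a j)\<^sup>2 * K j j / 2)"
      using assms by (simp add: ci cj ic)
    finally show ?thesis by (simp add: exp_add[symmetric] power2_eq_square add_divide_distrib)
  qed
  have sinP: "(\<integral>p. sin (a i * X i (fst p) + a j * X j (snd p)) \<partial>(M \<Otimes>\<^sub>M M)) = 0" for a
  proof -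
    have "(\<integral>p. sin (a i * X i (fst p) + a j * X j (snd p)) \<partial>(M \<Otimes>\<^sub>M M))
       = (\<integral>x. (\<integral>y. sin (a i * X i x) * cos (a j * X j y) + cos (a i * X i x) * sin (a j * X j y) \<partial>M) \<partial>M)"
      by (subst P.integral_fst'[symmetric]) (auto intro!: P.P.integrable_const_bound[of _ 1] simp flip: sin_add)
    also have "\<dots> = 0"
      using assms by (simp add: ci cj ic)
    finally show ?thesis .
  qed
  have "distr M borel (X i) \<Otimes>\<^sub>M distr M borel (X j) = distr M (borel \<Otimes>\<^sub>M borel) (\<lambda>\<omega>. (X i \<omega>, X j \<omega>))"
  proof (rule pair_measure_eqI)
    show "sigma_finite_measure (distr M borel (X i))" "sigma_finite_measure (distr M borel (X j))"
      by (auto intro!: prob_space_imp_sigma_finite prob_space_distr)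
    fix A B assume "A \<in> sets (distr M borel (X i))" "B \<in> sets (distr M borel (X j))"
    then have [measurable]: "A \<in> sets borel" "B \<in> sets borel" by auto
    have "prob {\<omega> \<in> space M. \<forall>k\<in>{i,j}. X k \<omega> \<in> (if k = i then A else B)}
        = measure (M \<Otimes>\<^sub>M M) {p \<in> space (M \<Otimes>\<^sub>M M). \<forall>k\<in>{i,j}. ?Y k p \<in> (if k = i then A else B)}"
      using assms by (intro measure_rectangle_eq[OF finite_measure_axioms P.P.finite_measure_axioms])
        (auto simp: sum cosP sinP expectation_cos_sum expectation_sin_sum var simp del: sum.insert)
    also have "{\<omega> \<in> space M. \<forall>k\<in>{i,j}. X k \<omega> \<in> (if k = i then A else B)} = (\<lambda>\<omega>. (X i \<omega>, X j \<omega>)) -` (A \<times> B) \<inter> space M"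
      using assms by auto
    also have "{p \<in> space (M \<Otimes>\<^sub>M M). \<forall>k\<in>{i,j}. ?Y k p \<in> (if k = i then A else B)} = (X i -` A \<inter> space M) \<times> (X j -` B \<inter> space M)"
      using assms by (auto simp: space_pair_measure)
    also have "measure (M \<Otimes>\<^sub>M M) \<dots> = prob (X i -` A \<inter> space M) * prob (X j -` B \<inter> space M)"
      by (simp add: measure_def emeasure_pair_measure_Times enn2real_mult)
    finally show "emeasure (distr M borel (X i)) A * emeasure (distr M borel (X j)) B = emeasure (distr M (borel \<Otimes>\<^sub>M borel) (\<lambda>\<omega>. (X i \<omega>, X j \<omega>))) (A \<times> B)"
      by (simp add: emeasure_distr emeasure_eq_measure ennreal_mult)
  qed simp
  then show ?thesis by (simp add: indep_var_distribution_eq)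
qed

end

section \<open>Cameron-Martin shifts\<close>

context centered_gaussian_process
begin

text \<open>Regression on \<open>X z\<close> splits the linear combination into a multiple of
  \<open>X z\<close> and a residual \<open>W\<close> uncorrelated with it. \<open>W\<close> is
  independent of the density \<open>D\<close>, a function of \<open>X z\<close> alone, so only a
  one-dimensional tilt remains.\<close>

lemma tilted_trig:
  fixes l :: real and c :: "'i \<Rightarrow> real"
  assumes S: "finite S" "S \<subseteq> T" and z: "z \<in> S" and v: "K z z > 0"
  defines "D \<equiv> \<lambda>\<omega>. exp (l * X z \<omega> - l\<^sup>2 * K z z / 2)"
    and "V \<equiv> \<lambda>\<omega>. \<Sum>k\<in>S. c k * (X k \<omega> - l * K k z)"
  shows "expectation (\<lambda>\<omega>. D \<omega> * cos (V \<omega>)) = expectation (\<lambda>\<omega>. cos (\<Sum>k\<in>S. c k * X k \<omega>))"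
    and "expectation (\<lambda>\<omega>. D \<omega> * sin (V \<omega>)) = expectation (\<lambda>\<omega>. sin (\<Sum>k\<in>S. c k * X k \<omega>))"
proof -
  have zT: "z \<in> T" using S z by auto
  have meas[measurable]: "X k \<in> borel_measurable M" if "k \<in> S" for k
    using measurable_process S that by auto
  note [measurable] = meas[OF z]
  have sym: "K s t = K t s" if "s \<in> S" "t \<in> S" for s t
    using cov[of s t] cov[of t s] that S by (auto simp: mult.commute)
  define m where "m = (\<Sum>k\<in>S. c k * K k z)"
  \<comment> \<open>Regression coefficient: covariance of the combination with \<open>X z\<close>
    over the variance of \<open>X z\<close>.\<close>
  define b where "b = m / K z z"
  have bv: "b * K z z = m" using v by (simp add: b_def)
  define q where "q = (\<Sum>s\<in>S. \<Sum>t\<in>S. c s * c t * K s t)"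
  define W where "W \<omega> = (\<Sum>k\<in>S. c k * X k \<omega>) - b * X z \<omega>" for \<omega>
  \<comment> \<open>Rows of coefficients: \<open>True\<close> selects \<open>X z\<close>,
    \<open>False\<close> the residual \<open>W\<close>.\<close>
  define B where "B j k = (if j then (if k = z then 1 else 0) else c k - (if k = z then b else 0))" for j :: bool and k
  have delta: "(\<Sum>t\<in>S. (if t = z then 1 else 0) * f t) = f z" "(\<Sum>t\<in>S. (if t = z then b else 0) * f t) = b * f z"
    for f :: "'i \<Rightarrow> real"
    using S z by (simp_all add: if_distrib[of "\<lambda>x. x * _"] cong: if_cong)
  have BX: "(\<Sum>t\<in>S. B True t * X t \<omega>) = X z \<omega>" "(\<Sum>t\<in>S. B False t * X t \<omega>) = W \<omega>" for \<omega>
    by (simp_all add: B_def W_def left_diff_distrib sum_subtractf delta)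
  define K' where "K' j k = (\<Sum>s\<in>S. \<Sum>t\<in>S. B j s * B k t * K s t)" for j k
  have K'1: "K' True True = K z z"
    by (simp add: K'_def B_def mult.assoc delta flip: sum_distrib_left)
  have K'2: "K' True False = 0"
  proof -
    have "K' True False = (\<Sum>s\<in>S. B True s * (\<Sum>t\<in>S. B False t * K s t))"
      by (simp add: K'_def sum_distrib_left mult.assoc)
    also have "\<dots> = (\<Sum>t\<in>S. B False t * K z t)" by (simp add: B_def delta)
    also have "\<dots> = (\<Sum>t\<in>S. c t * K z t) - b * K z z"
      by (simp add: B_def left_diff_distrib sum_subtractf delta)
    also have "(\<Sum>t\<in>S. c t * K z t) = m" unfolding m_def using sym z by (intro sum.cong) auto
    finally show ?thesis by (simp add: bv)
  qed
  have K'3: "K' False False = q - b * m"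
  proof -
    have "K' False False = (\<Sum>s\<in>S. B False s * (\<Sum>t\<in>S. B False t * K s t))"
      by (simp add: K'_def sum_distrib_left mult.assoc)
    also have "\<dots> = (\<Sum>s\<in>S. B False s * ((\<Sum>t\<in>S. c t * K s t) - b * K s z))"
      by (simp add: B_def left_diff_distrib sum_subtractf delta)
    also have "\<dots> = (\<Sum>s\<in>S. c s * ((\<Sum>t\<in>S. c t * K s t) - b * K s z)) - b * ((\<Sum>t\<in>S. c t * K z t) - b * K z z)"
      unfolding B_def by (simp add: left_diff_distrib[of "c _"] sum_subtractf delta)
    also have "(\<Sum>t\<in>S. c t * K z t) = m" unfolding m_def using sym z by (intro sum.cong) auto
    also have "(\<Sum>s\<in>S. c s * ((\<Sum>t\<in>S. c t * K s t) - b * K s z)) = q - b * m"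
      by (simp add: right_diff_distrib sum_subtractf q_def m_def sum_distrib_left mult_ac)
    finally show ?thesis by (simp add: bv)
  qed
  interpret G: centered_gaussian_process M "UNIV :: bool set" "\<lambda>j \<omega>. \<Sum>t\<in>S. B j t * X t \<omega>" K'
    using linear_image[OF S, of UNIV B] unfolding K'_def .
  have "indep_var borel (X z) borel W"
    using G.uncorrelated_indep[of True False] K'2 by (simp add: BX)
  note ind = this
  have [measurable]: "W \<in> borel_measurable M" unfolding W_def by measurable
  have W: "expectation (\<lambda>\<omega>. cos (W \<omega>)) = exp (- (q - b * m) / 2)" "expectation (\<lambda>\<omega>. sin (W \<omega>)) = 0"
    using G.expectation_cos_sum[of "{False}" "\<lambda>_. 1"] G.expectation_sin_sum[of "{False}" "\<lambda>_. 1"] K'3 by (simp_all add: BX)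
  have iW: "integrable M (\<lambda>\<omega>. cos (W \<omega>))" "integrable M (\<lambda>\<omega>. sin (W \<omega>))"
    by (auto intro!: integrable_const_bound[of _ 1])
  define gc where "gc x = exp (l * x - l\<^sup>2 * K z z / 2) * cos (b * x - l * m)" for x
  define gs where "gs x = exp (l * x - l\<^sup>2 * K z z / 2) * sin (b * x - l * m)" for x
  have [measurable]: "gc \<in> borel_measurable borel" "gs \<in> borel_measurable borel" unfolding gc_def gs_def by measurable
  have ie: "integrable M (\<lambda>\<omega>. exp (l * X z \<omega>))" by (rule centered_gaussian_integrable_exp[OF marginal[OF zT]])
  have ig0: "integrable M (\<lambda>\<omega>. exp (l * X z \<omega>) * cos (b * X z \<omega>))" "integrable M (\<lambda>\<omega>. exp (l * X z \<omega>) * sin (b * X z \<omega>))"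
    by (rule Bochner_Integration.integrable_bound[OF ie]; auto simp: abs_mult mult_left_le)+
  have gc: "gc x = exp (- l\<^sup>2 * K z z / 2) * (cos (l * m) * (exp (l * x) * cos (b * x)) + sin (l * m) * (exp (l * x) * sin (b * x)))"
    and gs: "gs x = exp (- l\<^sup>2 * K z z / 2) * (cos (l * m) * (exp (l * x) * sin (b * x)) - sin (l * m) * (exp (l * x) * cos (b * x)))" for x
  proof -
    have e: "exp (l * x - l\<^sup>2 * K z z / 2) = exp (- l\<^sup>2 * K z z / 2) * exp (l * x)"
      unfolding mult_exp_exp by (rule arg_cong[where f=exp]) simp
    show "gc x = exp (- l\<^sup>2 * K z z / 2) * (cos (l * m) * (exp (l * x) * cos (b * x)) + sin (l * m) * (exp (l * x) * sin (b * x)))"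
      "gs x = exp (- l\<^sup>2 * K z z / 2) * (cos (l * m) * (exp (l * x) * sin (b * x)) - sin (l * m) * (exp (l * x) * cos (b * x)))"
      unfolding gc_def gs_def e cos_diff sin_diff by (simp_all only: ring_distribs mult_ac)
  qed
  \<comment> \<open>The phase \<open>b * l * K z z\<close> created by the tilt equals the drift
    \<open>l * m\<close> that \<open>V\<close> subtracts, so the two cancel.\<close>
  have blv: "b * l * K z z = l * m" using bv by (simp add: mult.assoc mult.left_commute)
  have ec: "expectation (\<lambda>\<omega>. gc (X z \<omega>)) = exp (- (b * m) / 2)"
  proof -
    have "expectation (\<lambda>\<omega>. gc (X z \<omega>)) = exp (- l\<^sup>2 * K z z / 2) * (cos (l * m) * (exp ((l\<^sup>2 - b\<^sup>2) * K z z / 2) * cos (l * m)) + sin (l * m) * (exp ((l\<^sup>2 - b\<^sup>2) * K z z / 2) * sin (l * m)))"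
      unfolding gc using ig0 centered_gaussian_tilted_cos[OF marginal[OF zT], of l b] centered_gaussian_tilted_sin[OF marginal[OF zT], of l b]
      by (simp only: blv integral_mult_right_zero Bochner_Integration.integral_add integrable_mult_right)
    also have "\<dots> = exp (- l\<^sup>2 * K z z / 2) * exp ((l\<^sup>2 - b\<^sup>2) * K z z / 2) * ((cos (l * m))\<^sup>2 + (sin (l * m))\<^sup>2)"
      by (simp only: power2_eq_square ring_distribs mult_ac)
    also have "\<dots> = exp (- l\<^sup>2 * K z z / 2 + (l\<^sup>2 - b\<^sup>2) * K z z / 2)" by (simp only: exp_add sin_cos_squared_add2 mult_1_right)
    also have "- l\<^sup>2 * K z z / 2 + (l\<^sup>2 - b\<^sup>2) * K z z / 2 = - (b * m) / 2" by (simp add: bv[symmetric] field_simps power2_eq_square)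
    finally show ?thesis .
  qed
  have es: "expectation (\<lambda>\<omega>. gs (X z \<omega>)) = 0"
  proof -
    have "expectation (\<lambda>\<omega>. gs (X z \<omega>)) = exp (- l\<^sup>2 * K z z / 2) * (cos (l * m) * (exp ((l\<^sup>2 - b\<^sup>2) * K z z / 2) * sin (l * m)) - sin (l * m) * (exp ((l\<^sup>2 - b\<^sup>2) * K z z / 2) * cos (l * m)))"
      unfolding gs using ig0 centered_gaussian_tilted_cos[OF marginal[OF zT], of l b] centered_gaussian_tilted_sin[OF marginal[OF zT], of l b]
      by (simp only: blv integral_mult_right_zero Bochner_Integration.integral_diff integrable_mult_right)
    also have "\<dots> = 0" by simp
    finally show ?thesis .
  qed
  have ig: "integrable M (\<lambda>\<omega>. gc (X z \<omega>))" "integrable M (\<lambda>\<omega>. gs (X z \<omega>))"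
    unfolding gc gs using ig0 by simp_all
  have prod: "integrable M (\<lambda>\<omega>. f (X z \<omega>) * g (W \<omega>)) \<and> expectation (\<lambda>\<omega>. f (X z \<omega>) * g (W \<omega>)) = expectation (\<lambda>\<omega>. f (X z \<omega>)) * expectation (\<lambda>\<omega>. g (W \<omega>))"
    if [measurable]: "f \<in> borel_measurable borel" "g \<in> borel_measurable borel"
      and "integrable M (\<lambda>\<omega>. f (X z \<omega>))" "integrable M (\<lambda>\<omega>. g (W \<omega>))" for f g :: "real \<Rightarrow> real"
    using indep_var_lebesgue_integral[OF indep_var_compose[OF ind that(1,2)]] indep_var_integrable[OF indep_var_compose[OF ind that(1,2)]] that
    by (simp add: o_def)
  have VW: "V \<omega> = W \<omega> + (b * X z \<omega> - l * m)" for \<omega>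
    by (simp add: V_def W_def m_def right_diff_distrib sum_subtractf sum_distrib_left mult_ac)
  have "expectation (\<lambda>\<omega>. D \<omega> * cos (V \<omega>)) = expectation (\<lambda>\<omega>. gc (X z \<omega>) * cos (W \<omega>) - gs (X z \<omega>) * sin (W \<omega>))"
    unfolding VW cos_add D_def gc_def gs_def by (simp add: algebra_simps)
  also have "\<dots> = exp (- (b * m) / 2) * exp (- (q - b * m) / 2)"
    using prod[of gc cos] prod[of gs sin] ig iW by (simp add: ec es W)
  also have "\<dots> = exp (- q / 2)" unfolding exp_add[symmetric] by (simp add: field_simps)
  also have "\<dots> = expectation (\<lambda>\<omega>. cos (\<Sum>k\<in>S. c k * X k \<omega>))"
    by (simp add: expectation_cos_sum[OF S] q_def)
  finally show "expectation (\<lambda>\<omega>. D \<omega> * cos (V \<omega>)) = expectation (\<lambda>\<omega>. cos (\<Sum>k\<in>S. c k * X k \<omega>))" .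
  have "expectation (\<lambda>\<omega>. D \<omega> * sin (V \<omega>)) = expectation (\<lambda>\<omega>. gc (X z \<omega>) * sin (W \<omega>) + gs (X z \<omega>) * cos (W \<omega>))"
    unfolding VW sin_add D_def gc_def gs_def by (simp add: algebra_simps)
  also have "\<dots> = 0"
    using prod[of gc sin] prod[of gs cos] ig iW by (simp add: ec es W)
  finally show "expectation (\<lambda>\<omega>. D \<omega> * sin (V \<omega>)) = expectation (\<lambda>\<omega>. sin (\<Sum>k\<in>S. c k * X k \<omega>))"
    by (simp add: expectation_sin_sum[OF S])
qed

text \<open>By the preceding lemma, under the density the vector \<open>X k - l * K k z\<close> has
  the law of the original one. The drift is the covariance with the single coordinate
  \<open>X z\<close>, so the density involves no other coordinate.\<close>

theorem cameron_martin:
  assumes S: "finite S" "S \<subseteq> T" and z: "z \<in> S" and v: "K z z > 0"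
    and A: "\<And>k. k \<in> S \<Longrightarrow> A k \<in> sets borel"
  shows "prob {\<omega> \<in> space M. \<forall>k\<in>S. X k \<omega> + l * K k z \<in> A k}
       = expectation (\<lambda>\<omega>. exp (l * X z \<omega> - l\<^sup>2 * K z z / 2) * indicator {\<omega> \<in> space M. \<forall>k\<in>S. X k \<omega> \<in> A k} \<omega>)"
proof -
  have zT: "z \<in> T" using S z by auto
  have meas[measurable]: "X k \<in> borel_measurable M" if "k \<in> S" for k
    using measurable_process S that by auto
  note [measurable] = meas[OF z] A
  define D where "D \<omega> = exp (l * X z \<omega> - l\<^sup>2 * K z z / 2)" for \<omega>
  have [measurable]: "D \<in> borel_measurable M" unfolding D_def by measurable
  have D: "D \<omega> = exp (l * X z \<omega>) / exp (l\<^sup>2 * K z z / 2)" for \<omega> by (simp add: D_def exp_diff)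
  have iD: "integrable M D" unfolding D using centered_gaussian_integrable_exp[OF marginal[OF zT]] by simp
  have "expectation D = 1"
    unfolding D using centered_gaussian_exp[OF marginal[OF zT], of l] by simp
  have D0: "AE \<omega> in M. 0 \<le> D \<omega>" by (simp add: D_def)
  define Q where "Q = density M (\<lambda>\<omega>. ennreal (D \<omega>))"
  have "emeasure Q (space Q) = 1"
  proof -
    have "emeasure Q (space Q) = (\<integral>\<^sup>+\<omega>. ennreal (D \<omega>) * indicator (space M) \<omega> \<partial>M)"
      unfolding Q_def by (subst emeasure_density) simp_all
    also have "\<dots> = (\<integral>\<^sup>+\<omega>. ennreal (D \<omega>) \<partial>M)"
      by (rule nn_integral_cong) simp
    also have "\<dots> = ennreal (expectation D)"
      by (rule nn_integral_eq_integral[OF iD D0])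
    finally show ?thesis using \<open>expectation D = 1\<close> by simp
  qed
  then interpret Q: prob_space Q by (rule prob_spaceI)
  have spQ: "space Q = space M" by (simp add: Q_def)
  have dens: "(\<integral>\<omega>. f \<omega> \<partial>Q) = expectation (\<lambda>\<omega>. D \<omega> * f \<omega>)" if "f \<in> borel_measurable M" for f :: "'a \<Rightarrow> real"
    unfolding Q_def using that D0 by (subst integral_density) auto
  \<comment> \<open>The drift is also written into the sets: on the left it cancels, on the right it
    shifts the rectangle.\<close>
  have "measure Q {\<omega> \<in> space Q. \<forall>k\<in>S. X k \<omega> - l * K k z \<in> (\<lambda>x. x + l * K k z) -` A k}
      = prob {\<omega> \<in> space M. \<forall>k\<in>S. X k \<omega> \<in> (\<lambda>x. x + l * K k z) -` A k}"
  proof (rule measure_rectangle_eq)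
    show "finite_measure Q" "finite_measure M" "finite S" using S Q.finite_measure_axioms finite_measure_axioms by auto
    show "(\<lambda>\<omega>. X k \<omega> - l * K k z) \<in> borel_measurable Q" "X k \<in> borel_measurable M" if "k \<in> S" for k
      using meas[OF that] by (auto simp: Q_def)
    show "(\<lambda>x. x + l * K k z) -` A k \<in> sets borel" if "k \<in> S" for k
      using A[OF that] by (rule measurable_sets_borel[rotated]) simp
    show "(\<integral>\<omega>. cos (\<Sum>k\<in>S. c k * (X k \<omega> - l * K k z)) \<partial>Q) = expectation (\<lambda>\<omega>. cos (\<Sum>k\<in>S. c k * X k \<omega>))"
      "(\<integral>\<omega>. sin (\<Sum>k\<in>S. c k * (X k \<omega> - l * K k z)) \<partial>Q) = expectation (\<lambda>\<omega>. sin (\<Sum>k\<in>S. c k * X k \<omega>))" for c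
      unfolding tilted_trig[OF S z v, of l c, symmetric] D_def[symmetric] by (intro dens; measurable)+
  qed
  also have "{\<omega> \<in> space Q. \<forall>k\<in>S. X k \<omega> - l * K k z \<in> (\<lambda>x. x + l * K k z) -` A k} = {\<omega> \<in> space M. \<forall>k\<in>S. X k \<omega> \<in> A k}"
    by (auto simp: spQ)
  also have "measure Q {\<omega> \<in> space M. \<forall>k\<in>S. X k \<omega> \<in> A k} = (\<integral>\<omega>. indicator {\<omega> \<in> space M. \<forall>k\<in>S. X k \<omega> \<in> A k} \<omega> \<partial>Q)"
  proof -
    have "{\<omega> \<in> space M. \<forall>k\<in>S. X k \<omega> \<in> A k} \<inter> space Q = {\<omega> \<in> space M. \<forall>k\<in>S. X k \<omega> \<in> A k}" by (auto simp: spQ)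
    then show ?thesis by simp
  qed
  also have "\<dots> = expectation (\<lambda>\<omega>. D \<omega> * indicator {\<omega> \<in> space M. \<forall>k\<in>S. X k \<omega> \<in> A k} \<omega>)"
    using S by (intro dens) measurable
  finally show ?thesis by (simp add: D_def)
qed

end

section \<open>Fractional Gaussian walks\<close>

text \<open>Unlike in \<open>linear_image\<close>, the coordinates used may vary with
  \<open>k\<close> over an infinite range. This covers the rescaled grid, the reversed walk and the
  increments.\<close>

lemma (in centered_gaussian_process) two_term_image:
  fixes f g :: "'k \<Rightarrow> 'i" and \<alpha> \<beta> :: "'k \<Rightarrow> real"
  assumes f: "f ` I \<subseteq> T" and g: "g ` I \<subseteq> T"
  shows "centered_gaussian_process M I (\<lambda>k \<omega>. \<alpha> k * X (f k) \<omega> - \<beta> k * X (g k) \<omega>)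
    (\<lambda>j k. \<alpha> j * \<alpha> k * K (f j) (f k) - \<alpha> j * \<beta> k * K (f j) (g k) - \<beta> j * \<alpha> k * K (g j) (f k) + \<beta> j * \<beta> k * K (g j) (g k))"
proof
  show "gaussian_process M I (\<lambda>k \<omega>. \<alpha> k * X (f k) \<omega> - \<beta> k * X (g k) \<omega>)"
    unfolding gaussian_process_def
  proof safe
    fix J and a :: "'k \<Rightarrow> real" assume J: "finite J" "J \<subseteq> I"
    define U where "U = f ` J \<union> g ` J"
    have U: "finite U" "U \<subseteq> T" using J f g by (auto simp: U_def)
    \<comment> \<open>\<open>f\<close> and \<open>g\<close> may fail to be injective, so
      coefficients that meet at the same \<open>t\<close> are added up.\<close>
    have reindex: "(\<Sum>k\<in>J. c k * X (h k) \<omega>) = (\<Sum>t\<in>U. (\<Sum>k\<in>J. if t = h k then c k else 0) * X t \<omega>)"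
      if "h ` J \<subseteq> U" for h c \<omega>
    proof -
      have "(\<Sum>t\<in>U. (\<Sum>k\<in>J. if t = h k then c k else 0) * X t \<omega>) = (\<Sum>k\<in>J. \<Sum>t\<in>U. if t = h k then c k * X t \<omega> else 0)"
        unfolding sum_distrib_right by (subst sum.swap) (auto intro!: sum.cong)
      also have "\<dots> = (\<Sum>k\<in>J. c k * X (h k) \<omega>)"
        using U that by (intro sum.cong) auto
      finally show ?thesis ..
    qed
    have "(\<Sum>k\<in>J. a k * (\<alpha> k * X (f k) \<omega> - \<beta> k * X (g k) \<omega>))
      = (\<Sum>t\<in>U. ((\<Sum>k\<in>J. if t = f k then a k * \<alpha> k else 0) - (\<Sum>k\<in>J. if t = g k then a k * \<beta> k else 0)) * X t \<omega>)" for \<omega>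
    proof -
      have "(\<Sum>k\<in>J. a k * (\<alpha> k * X (f k) \<omega> - \<beta> k * X (g k) \<omega>)) = (\<Sum>k\<in>J. a k * \<alpha> k * X (f k) \<omega>) - (\<Sum>k\<in>J. a k * \<beta> k * X (g k) \<omega>)"
        by (simp add: right_diff_distrib sum_subtractf mult.assoc)
      then show ?thesis
        using reindex[of f "\<lambda>k. a k * \<alpha> k" \<omega>] reindex[of g "\<lambda>k. a k * \<beta> k" \<omega>]
        by (simp add: U_def left_diff_distrib sum_subtractf)
    qed
    then show "gaussian_rv M (\<lambda>\<omega>. \<Sum>k\<in>J. a k * (\<alpha> k * X (f k) \<omega> - \<beta> k * X (g k) \<omega>))"
      using gaussian_sum[OF U] by simp
  qed
  show "centered_process M I (\<lambda>k \<omega>. \<alpha> k * X (f k) \<omega> - \<beta> k * X (g k) \<omega>)"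
    unfolding centered_process_def
  proof
    fix k assume "k \<in> I"
    then have "f k \<in> T" "g k \<in> T" using f g by auto
    then show "expectation (\<lambda>\<omega>. \<alpha> k * X (f k) \<omega> - \<beta> k * X (g k) \<omega>) = 0"
      using expectation_zero integrable_process by simp
  qed
  fix j k assume "j \<in> I" "k \<in> I"
  then have T: "f j \<in> T" "g j \<in> T" "f k \<in> T" "g k \<in> T" using f g by auto
  have "(\<alpha> j * X (f j) \<omega> - \<beta> j * X (g j) \<omega>) * (\<alpha> k * X (f k) \<omega> - \<beta> k * X (g k) \<omega>)
    = \<alpha> j * \<alpha> k * (X (f j) \<omega> * X (f k) \<omega>) - \<alpha> j * \<beta> k * (X (f j) \<omega> * X (g k) \<omega>) - \<beta> j * \<alpha> k * (X (g j) \<omega> * X (f k) \<omega>)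
      + \<beta> j * \<beta> k * (X (g j) \<omega> * X (g k) \<omega>)" for \<omega>
    by (simp add: algebra_simps)
  then show "expectation (\<lambda>\<omega>. (\<alpha> j * X (f j) \<omega> - \<beta> j * X (g j) \<omega>) * (\<alpha> k * X (f k) \<omega> - \<beta> k * X (g k) \<omega>))
    = \<alpha> j * \<alpha> k * K (f j) (f k) - \<alpha> j * \<beta> k * K (f j) (g k) - \<beta> j * \<alpha> k * K (g j) (f k) + \<beta> j * \<beta> k * K (g j) (g k)"
    using T by (simp add: integrable_mult cov)
qed

definition fbm_cov :: "real \<Rightarrow> real \<Rightarrow> real \<Rightarrow> real" where
  "fbm_cov H s t = (\<bar>s\<bar> powr (2 * H) + \<bar>t\<bar> powr (2 * H) - \<bar>s - t\<bar> powr (2 * H)) / 2"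

locale fractional_walk = centered_gaussian_process M UNIV Y "\<lambda>j k. fbm_cov H (real j) (real k)"
  for M :: "'a measure" and Y :: "nat \<Rightarrow> 'a \<Rightarrow> real" and H :: real +
  assumes H: "0 < H" "H < 1"
begin

lemma Y_meas[measurable]: "Y k \<in> borel_measurable M"
  using measurable_process by simp

lemma Y_integrable[simp]: "integrable M (Y k)"
  using integrable_process by simp

lemma var_Y: "fbm_cov H (real k) (real k) = real k powr (2 * H)"
  by (simp add: fbm_cov_def)

lemma exp_Y_integrable[simp]: "integrable M (\<lambda>\<omega>. exp (l * Y k \<omega>))"
  using centered_gaussian_integrable_exp[OF marginal, of k] by simp

lemma expectation_exp_Y: "expectation (\<lambda>\<omega>. exp (l * Y k \<omega>)) = exp (l\<^sup>2 * real k powr (2 * H) / 2)"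
  using centered_gaussian_exp[OF marginal, of k] by (simp add: var_Y)

lemma expectation_Y: "expectation (Y k) = 0"
  by (simp add: expectation_zero)

lemma Y_0: "AE \<omega> in M. Y 0 \<omega> = 0"
proof -
  have "expectation (\<lambda>\<omega>. (Y 0 \<omega>)\<^sup>2) = 0" using variance[of 0] H by (simp add: fbm_cov_def)
  then have "AE \<omega> in M. (Y 0 \<omega>)\<^sup>2 = 0"
    using square_integrable[of 0] by (subst (asm) integral_nonneg_eq_0_iff_AE) auto
  then show ?thesis by simp
qed

section \<open>Exponential sums and their mean logarithm\<close>

definition expsum :: "nat \<Rightarrow> 'a \<Rightarrow> real" where "expsum n \<omega> = (\<Sum>k<n. exp (Y k \<omega>))"
text \<open>The sum met after time reversal: \<open>n - k\<close> runs through \<open>{1..n}\<close>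
  as \<open>k\<close> runs through \<open>{..<n}\<close>.\<close>

definition expsum1 :: "nat \<Rightarrow> 'a \<Rightarrow> real" where "expsum1 n \<omega> = (\<Sum>k=1..n. exp (Y k \<omega>))"
definition mean_log :: "nat \<Rightarrow> real" where "mean_log n = expectation (\<lambda>\<omega>. ln (expsum n \<omega>))"
definition mean_gain :: "nat \<Rightarrow> real" where "mean_gain n = expectation (\<lambda>\<omega>. ln (1 + 1 / expsum1 n \<omega>))"

lemma expsum_meas[measurable]: "expsum n \<in> borel_measurable M" and expsum1_meas[measurable]: "expsum1 n \<in> borel_measurable M"
  unfolding expsum_def expsum1_def by measurable

lemma expsum_pos: "n \<ge> 1 \<Longrightarrow> expsum n \<omega> > 0" unfolding expsum_def by (intro sum_pos) (auto simp: lessThan_empty_iff)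
lemma expsum1_pos: "n \<ge> 1 \<Longrightarrow> expsum1 n \<omega> > 0" unfolding expsum1_def by (intro sum_pos) auto

lemma exp_le_expsum: "k < n \<Longrightarrow> exp (Y k \<omega>) \<le> expsum n \<omega>"
  unfolding expsum_def by (rule member_le_sum) auto

lemma exp_le_expsum1: "1 \<le> k \<Longrightarrow> k \<le> n \<Longrightarrow> exp (Y k \<omega>) \<le> expsum1 n \<omega>"
  unfolding expsum1_def by (rule member_le_sum) auto

lemma expsum_le: "(\<And>k. k < n \<Longrightarrow> Y k \<omega> \<le> m) \<Longrightarrow> expsum n \<omega> \<le> real n * exp m"
  unfolding expsum_def using sum_bounded_above[of "{..<n}" "\<lambda>k. exp (Y k \<omega>)" "exp m"] by simp

lemma ln_expsum_le:
  assumes "n \<ge> 1" "\<And>k. k < n \<Longrightarrow> Y k \<omega> \<le> m"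
  shows "ln (expsum n \<omega>) \<le> ln (real n) + m"
proof -
  have "ln (expsum n \<omega>) \<le> ln (real n * exp m)"
    using expsum_le[OF assms(2)] expsum_pos[OF assms(1), of \<omega>] assms(1) by (subst ln_le_cancel_iff) auto
  then show ?thesis using assms(1) by (simp add: ln_mult_pos)
qed

lemma ln_expsum_integrable:
  assumes "n \<ge> 1"
  shows "integrable M (\<lambda>\<omega>. ln (expsum n \<omega>))"
proof (rule Bochner_Integration.integrable_bound)
  show "integrable M (\<lambda>\<omega>. ln (real n) + (\<Sum>k<n. \<bar>Y k \<omega>\<bar>))" by simp
  have "\<bar>ln (expsum n \<omega>)\<bar> \<le> ln (real n) + (\<Sum>k<n. \<bar>Y k \<omega>\<bar>)" for \<omega>
  proof -
    have Y: "\<bar>Y k \<omega>\<bar> \<le> (\<Sum>k<n. \<bar>Y k \<omega>\<bar>)" if "k < n" for k using that by (intro member_le_sum) auto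
    have "Y k \<omega> \<le> (\<Sum>k<n. \<bar>Y k \<omega>\<bar>)" if "k < n" for k using Y[OF that] by linarith
    then have "ln (expsum n \<omega>) \<le> ln (real n) + (\<Sum>k<n. \<bar>Y k \<omega>\<bar>)" by (rule ln_expsum_le[OF assms])
    moreover have "Y 0 \<omega> \<le> ln (expsum n \<omega>)"
      using exp_le_expsum[of 0 n \<omega>] expsum_pos[of n \<omega>] assms by (simp add: ln_ge_iff)
    moreover have "\<bar>Y 0 \<omega>\<bar> \<le> (\<Sum>k<n. \<bar>Y k \<omega>\<bar>)" using Y[of 0] assms by simp
    moreover have "0 \<le> ln (real n)" using assms by simp
    ultimately show ?thesis by linarith
  qed
  moreover have "0 \<le> ln (real n) + (\<Sum>k<n. \<bar>Y k \<omega>\<bar>)" for \<omega> using assms by (intro add_nonneg_nonneg sum_nonneg) auto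
  ultimately show "AE \<omega> in M. norm (ln (expsum n \<omega>)) \<le> norm (ln (real n) + (\<Sum>k<n. \<bar>Y k \<omega>\<bar>))" by simp
qed simp

text \<open>Both vectors have covariance \<open>fbm_cov H (real (n - j)) (real (n - k))\<close>:
  seen from its endpoint and backwards in time, the walk is again a fractional walk.\<close>

lemma reversal:
  assumes [measurable]: "F \<in> borel_measurable (PiM {..<n} (\<lambda>_. borel))"
  shows "expectation (\<lambda>\<omega>. F (\<lambda>k\<in>{..<n}. Y k \<omega> - Y n \<omega>)) = expectation (\<lambda>\<omega>. F (\<lambda>k\<in>{..<n}. Y (n - k) \<omega>) :: real)"
proof -
  have 1: "centered_gaussian_process M {..<n} (\<lambda>k \<omega>. Y k \<omega> - Y n \<omega>) (\<lambda>j k. fbm_cov H (real (n - j)) (real (n - k)))"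
    if "\<And>j k. j < n \<Longrightarrow> k < n \<Longrightarrow> fbm_cov H (real j) (real k) - fbm_cov H (real j) (real n) - fbm_cov H (real n) (real k) + fbm_cov H (real n) (real n)
       = fbm_cov H (real (n - j)) (real (n - k))"
    using two_term_image[of "\<lambda>k. k" "{..<n}" "\<lambda>_. n" "\<lambda>_. 1" "\<lambda>_. 1"] that
    by (simp add: centered_gaussian_process_def centered_gaussian_process_axioms_def)
  have 2: "centered_gaussian_process M {..<n} (\<lambda>k \<omega>. Y (n - k) \<omega>) (\<lambda>j k. fbm_cov H (real (n - j)) (real (n - k)))"
    using two_term_image[of "\<lambda>k. n - k" "{..<n}" "\<lambda>_. 0" "\<lambda>_. 1" "\<lambda>_. 0"] by simp
  have "fbm_cov H (real j) (real k) - fbm_cov H (real j) (real n) - fbm_cov H (real n) (real k) + fbm_cov H (real n) (real n)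
       = fbm_cov H (real (n - j)) (real (n - k))" if "j < n" "k < n" for j k
    using that by (simp add: fbm_cov_def of_nat_diff abs_minus_commute field_simps)
  from centered_gaussian_process_law_eq[OF 1[OF this] 2, of "{..<n}"]
  have eq: "distr M (PiM {..<n} (\<lambda>_. borel)) (\<lambda>\<omega>. \<lambda>k\<in>{..<n}. Y k \<omega> - Y n \<omega>) = distr M (PiM {..<n} (\<lambda>_. borel)) (\<lambda>\<omega>. \<lambda>k\<in>{..<n}. Y (n - k) \<omega>)"
    by simp
  have "expectation (\<lambda>\<omega>. F (\<lambda>k\<in>{..<n}. Y k \<omega> - Y n \<omega>)) = (\<integral>x. F x \<partial>distr M (PiM {..<n} (\<lambda>_. borel)) (\<lambda>\<omega>. \<lambda>k\<in>{..<n}. Y k \<omega> - Y n \<omega>))"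
    by (rule integral_distr[symmetric]) measurable
  also have "\<dots> = expectation (\<lambda>\<omega>. F (\<lambda>k\<in>{..<n}. Y (n - k) \<omega>))"
    unfolding eq by (rule integral_distr) measurable
  finally show ?thesis .
qed

text \<open>Molchan's identity. The ratio of the new term to the old sum is
  \<open>1 / (\<Sum>k<n. exp (Y k - Y n))\<close>, and the increments of the walk are stationary.\<close>

lemma mean_log_Suc:
  assumes "n \<ge> 1"
  shows "mean_log (Suc n) = mean_log n + mean_gain n"
proof -
  define F where "F x = ln (1 + 1 / (\<Sum>k<n. exp (x k)))" for x :: "nat \<Rightarrow> real"
  have [measurable]: "F \<in> borel_measurable (PiM {..<n} (\<lambda>_. borel))" unfolding F_def by measurable
  have "ln (expsum (Suc n) \<omega>) - ln (expsum n \<omega>) = F (\<lambda>k\<in>{..<n}. Y k \<omega> - Y n \<omega>)" for \<omega>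
  proof -
    have "(\<Sum>k<n. exp (Y k \<omega> - Y n \<omega>)) = expsum n \<omega> / exp (Y n \<omega>)" by (simp add: expsum_def exp_diff sum_divide_distrib)
    moreover have "expsum (Suc n) \<omega> = expsum n \<omega> * (1 + exp (Y n \<omega>) / expsum n \<omega>)"
      using expsum_pos[OF assms, of \<omega>] by (simp add: expsum_def field_simps)
    moreover have "1 + exp (Y n \<omega>) / expsum n \<omega> > 0" using expsum_pos[OF assms, of \<omega>] by (simp add: add_pos_pos)
    ultimately show ?thesis using expsum_pos[OF assms, of \<omega>] by (simp add: F_def ln_mult_pos)
  qed
  moreover have "F (\<lambda>k\<in>{..<n}. Y (n - k) \<omega>) = ln (1 + 1 / expsum1 n \<omega>)" for \<omega>
  proof -
    have "(\<Sum>k<n. exp (Y (n - k) \<omega>)) = expsum1 n \<omega>" unfolding expsum1_def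
      by (rule sum.reindex_bij_witness[of _ "\<lambda>k. n - k" "\<lambda>k. n - k"]) auto
    then show ?thesis by (simp add: F_def)
  qed
  ultimately have "expectation (\<lambda>\<omega>. ln (expsum (Suc n) \<omega>) - ln (expsum n \<omega>)) = mean_gain n"
    using reversal[of F n] by (simp add: mean_gain_def)
  then show ?thesis using ln_expsum_integrable[of n] ln_expsum_integrable[of "Suc n"] assms by (simp add: mean_log_def)
qed

text \<open>The single summand \<open>exp (Y 1 \<omega>)\<close> bounds the sum from below. The
  resulting majorant does not depend on \<open>n\<close>; it gives integrability and later controls
  the integrand on the persistence event.\<close>

lemma ln_expsum1:
  assumes "n \<ge> 1"
  shows ln_expsum1_nonneg: "0 \<le> ln (1 + 1 / expsum1 n \<omega>)" and ln_expsum1_le: "ln (1 + 1 / expsum1 n \<omega>) \<le> 1 + \<bar>Y 1 \<omega>\<bar>"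
proof -
  note expsum1 = expsum1_pos[OF assms, of \<omega>]
  show "0 \<le> ln (1 + 1 / expsum1 n \<omega>)" using expsum1 by simp
  have "1 / expsum1 n \<omega> \<le> exp (- Y 1 \<omega>)"
    using exp_le_expsum1[of 1 n \<omega>] assms expsum1 by (simp add: exp_minus divide_inverse le_imp_inverse_le)
  also have "\<dots> \<le> exp \<bar>Y 1 \<omega>\<bar>" by simp
  finally have "1 + 1 / expsum1 n \<omega> \<le> 2 * exp \<bar>Y 1 \<omega>\<bar>" using one_le_exp_iff[of "\<bar>Y 1 \<omega>\<bar>"] by linarith
  also have "\<dots> \<le> exp 1 * exp \<bar>Y 1 \<omega>\<bar>" using exp_ge_add_one_self[of 1] by (intro mult_right_mono) auto
  finally have "1 + 1 / expsum1 n \<omega> \<le> exp (1 + \<bar>Y 1 \<omega>\<bar>)" by (simp add: exp_add)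
  then have "ln (1 + 1 / expsum1 n \<omega>) \<le> ln (exp (1 + \<bar>Y 1 \<omega>\<bar>))" using expsum1 by (subst ln_le_cancel_iff) (auto simp: add_pos_pos)
  then show "ln (1 + 1 / expsum1 n \<omega>) \<le> 1 + \<bar>Y 1 \<omega>\<bar>" by simp
qed

lemma ln_expsum1_integrable:
  assumes "n \<ge> 1"
  shows "integrable M (\<lambda>\<omega>. ln (1 + 1 / expsum1 n \<omega>))"
proof (rule Bochner_Integration.integrable_bound)
  show "integrable M (\<lambda>\<omega>. 1 + \<bar>Y 1 \<omega>\<bar>)" by simp
  show "AE \<omega> in M. norm (ln (1 + 1 / expsum1 n \<omega>)) \<le> norm (1 + \<bar>Y 1 \<omega>\<bar>)"
    using ln_expsum1[OF assms] by (intro AE_I2) (metis abs_of_nonneg abs_ge_self order_trans real_norm_def)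
qed simp

lemma mean_gain_antimono:
  assumes "1 \<le> m" "m \<le> n"
  shows "mean_gain n \<le> mean_gain m"
  unfolding mean_gain_def
proof (intro integral_mono ln_expsum1_integrable)
  fix \<omega>
  have "expsum1 m \<omega> \<le> expsum1 n \<omega>" unfolding expsum1_def using assms by (intro sum_mono2) auto
  then have "1 / expsum1 n \<omega> \<le> 1 / expsum1 m \<omega>" using expsum1_pos[of m \<omega>] assms by (intro divide_left_mono) auto
  moreover have "0 < 1 / expsum1 n \<omega>" using expsum1_pos[of n \<omega>] assms by simp
  ultimately show "ln (1 + 1 / expsum1 n \<omega>) \<le> ln (1 + 1 / expsum1 m \<omega>)" by (subst ln_le_cancel_iff) linarith+
qed (use assms in auto)

lemma mean_log_add:
  assumes "1 \<le> n"
  shows "mean_log (n + m) = mean_log n + (\<Sum>k=n..<n+m. mean_gain k)"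
  by (induction m) (use assms in \<open>auto simp: mean_log_Suc\<close>)

lemma mean_log_1: "mean_log 1 = 0"
  by (simp add: mean_log_def expsum_def expectation_Y)

text \<open>Gains decrease, so \<open>n\<close> times the last one is at most their sum from 1 to
  \<open>n\<close>, which telescopes from \<open>mean_log 1 = 0\<close>.\<close>

lemma mean_gain_le_mean_log:
  assumes "n \<ge> 1"
  shows "real n * mean_gain n \<le> mean_log (n + 1)"
proof -
  have "real n * mean_gain n = (\<Sum>k=1..<1+n. mean_gain n)" by simp
  also have "\<dots> \<le> (\<Sum>k=1..<1+n. mean_gain k)" using mean_gain_antimono by (intro sum_mono) auto
  also have "\<dots> = mean_log (1 + n)" using mean_log_add[of 1 n] mean_log_1 by simp
  finally show ?thesis by (simp add: add.commute)
qed

lemma mean_log_diff_le: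
  assumes "n \<ge> 1"
  shows "mean_log (n + m) - mean_log n \<le> real m * mean_gain n"
proof -
  have "mean_log (n + m) - mean_log n = (\<Sum>k=n..<n+m. mean_gain k)" using mean_log_add[OF assms] by simp
  also have "\<dots> \<le> (\<Sum>k=n..<n+m. mean_gain n)" using mean_gain_antimono assms by (intro sum_mono) auto
  finally show ?thesis by simp
qed

text \<open>The maximum is controlled by exponential moments at scale \<open>q\<close>, which bounds
  all standard deviations. The logarithm of the sum of \<open>exp (Y k / q)\<close> is replaced by
  its tangent at \<open>c\<close>, so that expectations can be taken term by term.\<close>

lemma mean_log_le:
  assumes "n \<ge> 1"
  shows "mean_log n \<le> ln (real n) + real n powr H * (ln (real n) + 1 / 2)"
proof -
  define q where "q = real n powr H"
  have q: "q > 0" using assms by (simp add: q_def)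
  \<comment> \<open>Tangent point: \<open>c\<close> bounds the expected sum, since each
    \<open>exp (Y k / q)\<close> has mean at most \<open>exp (1 / 2)\<close>. In expectation the
    linear correction is therefore at most 0.\<close>
  define c where "c = real n * exp (1 / 2)"
  have c: "c > 0" using assms by (simp add: c_def)
  define m where "m \<omega> = q * (ln c + (\<Sum>k<n. exp (1 / q * Y k \<omega>)) / c - 1)" for \<omega>
  have "ln (expsum n \<omega>) \<le> ln (real n) + m \<omega>" for \<omega>
  proof (rule ln_expsum_le[OF assms])
    fix k assume "k < n"
    have "Y k \<omega> / q = ln c + ln (exp (1 / q * Y k \<omega>) / c)" using c by (simp add: ln_div)
    also have "\<dots> \<le> ln c + (exp (1 / q * Y k \<omega>) / c - 1)" using c by (intro add_left_mono ln_le_minus_one) auto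
    also have "exp (1 / q * Y k \<omega>) / c \<le> (\<Sum>k<n. exp (1 / q * Y k \<omega>)) / c"
      using c \<open>k < n\<close> by (intro divide_right_mono member_le_sum) auto
    finally have "Y k \<omega> / q \<le> ln c + (\<Sum>k<n. exp (1 / q * Y k \<omega>)) / c - 1" by simp
    then show "Y k \<omega> \<le> m \<omega>" using q by (simp add: m_def pos_divide_le_eq mult.commute)
  qed
  moreover have im: "integrable M m"
    unfolding m_def using exp_Y_integrable[of "1 / q"] by (intro integrable_mult_right Bochner_Integration.integrable_add Bochner_Integration.integrable_diff integrable_divide Bochner_Integration.integrable_sum) auto
  ultimately have "mean_log n \<le> expectation (\<lambda>\<omega>. ln (real n) + m \<omega>)"
    unfolding mean_log_def using ln_expsum_integrable[OF assms] by (intro integral_mono) auto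
  also have "\<dots> = ln (real n) + expectation m" using im by (simp add: prob_space)
  also have "expectation m = q * (ln c + (\<Sum>k<n. exp ((1 / q)\<^sup>2 * real k powr (2 * H) / 2)) / c - 1)"
    unfolding m_def by (simp add: prob_space expectation_exp_Y del: times_divide_eq_left)
  also have "\<dots> \<le> q * (ln (real n) + 1 / 2)"
  proof (rule mult_left_mono)
    have "exp ((1 / q)\<^sup>2 * real k powr (2 * H) / 2) \<le> exp (1 / 2)" if "k < n" for k
    proof -
      have "real k powr (2 * H) \<le> real n powr (2 * H)" using that H by (intro powr_mono2) auto
      also have "\<dots> = q\<^sup>2" by (simp add: q_def powr_add[symmetric] power2_eq_square)
      finally have "real k powr (2 * H) / q\<^sup>2 \<le> 1" using q by (simp add: divide_le_eq_1)
      then show ?thesis by (simp add: power_divide)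
    qed
    then have "(\<Sum>k<n. exp ((1 / q)\<^sup>2 * real k powr (2 * H) / 2)) \<le> c"
      using sum_bounded_above[of "{..<n}" "\<lambda>k. exp ((1 / q)\<^sup>2 * real k powr (2 * H) / 2)" "exp (1 / 2)"] by (simp add: c_def)
    then have "(\<Sum>k<n. exp ((1 / q)\<^sup>2 * real k powr (2 * H) / 2)) / c \<le> 1" using c by simp
    moreover have "ln c = ln (real n) + 1 / 2" using assms by (simp add: c_def ln_mult_pos)
    ultimately show "ln c + (\<Sum>k<n. exp ((1 / q)\<^sup>2 * real k powr (2 * H) / 2)) / c - 1 \<le> ln (real n) + 1 / 2" by linarith
  qed (use q in simp)
  finally show ?thesis by (simp add: q_def)
qed

text \<open>The sum contains \<open>exp (Y 0)\<close>, almost surely 1, and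
  \<open>exp (Y (n - 1))\<close>, so its logarithm is at least the positive part of
  \<open>Y (n - 1)\<close>. The 8 collects three losses of a factor 2: the positive part has half
  the mean of the modulus, \<open>sqrt (2 / pi) \<ge> 1 / 2\<close>, and
  \<open>n \<le> 2 * (n - 1)\<close>.\<close>

lemma mean_log_ge:
  assumes "n \<ge> 2"
  shows "mean_log n \<ge> real n powr H / 8"
proof -
  let ?Y = "Y (n - 1)"
  have "1 / 2 \<le> sqrt (2 / pi)"
    using pi_less_4 by (intro real_le_rsqrt) (simp add: power2_eq_square field_simps)
  have "real n powr H \<le> (2 * real (n - 1)) powr H" using assms H by (intro powr_mono2) auto
  also have "\<dots> = 2 powr H * real (n - 1) powr H" by (simp add: powr_mult)
  also have "\<dots> \<le> 2 * real (n - 1) powr H" using H powr_mono[of H 1 "2::real"] by (intro mult_right_mono) auto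
  finally have "real n powr H / 8 \<le> 1 / 2 * (1 / 2 * real (n - 1) powr H)" by simp
  also have "\<dots> \<le> 1 / 2 * (sqrt (2 / pi) * real (n - 1) powr H)"
    using \<open>1 / 2 \<le> sqrt (2 / pi)\<close> by (intro mult_left_mono mult_right_mono) auto
  also have "sqrt (real (n - 1) powr (2 * H)) = real (n - 1) powr H"
    by (simp add: powr_half_sqrt[symmetric] powr_powr)
  then have "sqrt (2 / pi) * real (n - 1) powr H = expectation (\<lambda>\<omega>. \<bar>?Y \<omega>\<bar>)"
    using centered_gaussian_abs[OF marginal, of "n - 1"] by (simp add: var_Y)
  also have "1 / 2 * \<dots> = expectation (\<lambda>\<omega>. (?Y \<omega> + \<bar>?Y \<omega>\<bar>) / 2)" by (simp add: expectation_Y)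
  also have "\<dots> \<le> mean_log n" unfolding mean_log_def
  proof (rule integral_mono_AE)
    show "AE \<omega> in M. (?Y \<omega> + \<bar>?Y \<omega>\<bar>) / 2 \<le> ln (expsum n \<omega>)"
      using Y_0
    proof eventually_elim
      case (elim \<omega>)
      have "Y k \<omega> \<le> ln (expsum n \<omega>)" if "k < n" for k
        using exp_le_expsum[of k n \<omega>] expsum_pos[of n \<omega>] assms that by (simp add: ln_ge_iff)
      from this[of 0] this[of "n - 1"] show ?case using assms elim by simp
    qed
  qed (use ln_expsum_integrable[of n] assms in auto)
  finally show ?thesis .
qed

end

section \<open>Persistence probabilities of the walk\<close>

lemma ln_ge_1: "n \<ge> 3 \<Longrightarrow> 1 \<le> ln (real n)"
  using exp_le by (simp add: ln_ge_iff)

text \<open>Here \<open>mean_log\<close> is merely a set variable; the constant of that name exists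
  only inside \<open>fractional_walk\<close>.\<close>

lemma (in finite_measure) integrable_indicat_real: "mean_log \<in> sets M \<Longrightarrow> integrable M (indicat_real mean_log)"
  by (rule integrable_const_bound[of _ 1]) (auto simp: indicator_def)

text \<open>Holds even for \<open>H < 1 / 2\<close>, where increments are negatively correlated,
  since \<open>\<bar>s - t\<bar> \<le> max s t\<close>. Hence the drift of a tilt has the same sign
  at all times.\<close>

lemma fbm_cov_nonneg:
  assumes "0 < H" "0 \<le> s" "0 \<le> t"
  shows "0 \<le> fbm_cov H s t"
proof -
  have "\<bar>s - t\<bar> powr (2 * H) \<le> (max s t) powr (2 * H)" using assms by (intro powr_mono2) auto
  also have "\<dots> \<le> \<bar>s\<bar> powr (2 * H) + \<bar>t\<bar> powr (2 * H)" using assms by (simp add: max_def)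
  finally show ?thesis by (simp add: fbm_cov_def)
qed

text \<open>Because \<open>s - t \<le> s\<close>, the covariance with an earlier value never falls
  below half the variance of that value. This bounds the drift of a tilt from below at all later
  times.\<close>

lemma fbm_cov_ge:
  assumes "0 < H" "0 \<le> t" "t \<le> s"
  shows "t powr (2 * H) / 2 \<le> fbm_cov H s t"
proof -
  have "\<bar>s - t\<bar> powr (2 * H) \<le> s powr (2 * H)" using assms by (intro powr_mono2) auto
  then show ?thesis using assms by (simp add: fbm_cov_def)
qed

context fractional_walk
begin

lemma mean_log_le_ln:
  assumes "n \<ge> 3"
  shows "mean_log n \<le> 3 * (real n powr H * ln (real n))"
proof -
  define q where "q = real n powr H"
  have q: "1 \<le> q" using assms H by (simp add: q_def ge_one_powr_ge_zero)
  note l = ln_ge_1[OF assms]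
  have "mean_log n \<le> ln (real n) + q * (ln (real n) + 1 / 2)" using mean_log_le[of n] assms by (simp add: q_def)
  also have "\<dots> \<le> q * ln (real n) + q * (ln (real n) + ln (real n))"
    using q l by (intro add_mono mult_left_mono) (auto simp: mult_le_cancel_right1)
  finally show ?thesis by (simp add: q_def algebra_simps)
qed

lemma mean_gain_upper:
  assumes "n \<ge> 3"
  shows "mean_gain n \<le> 12 * (real n powr (H - 1) * ln (real n))"
proof -
  note l = ln_ge_1[OF assms]
  have "real (n + 1) powr H \<le> (2 * real n) powr H" using assms H by (intro powr_mono2) auto
  also have "\<dots> = 2 powr H * real n powr H" by (simp add: powr_mult)
  also have "\<dots> \<le> 2 * real n powr H" using H powr_mono[of H 1 "2::real"] by (intro mult_right_mono) auto
  finally have 1: "real (n + 1) powr H \<le> 2 * real n powr H" .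
  have "n + 1 \<le> n * n" using assms using mult_le_mono1[of 3 n n] by linarith
  then have "real (n + 1) \<le> real n * real n" by (simp flip: of_nat_mult)
  then have "ln (real (n + 1)) \<le> ln (real n * real n)" using assms by (subst ln_le_cancel_iff) auto
  then have 2: "ln (real (n + 1)) \<le> 2 * ln (real n)" using assms by (simp add: ln_mult_pos)
  have "real n * mean_gain n \<le> 3 * (real (n + 1) powr H * ln (real (n + 1)))"
    using mean_gain_le_mean_log[of n] mean_log_le_ln[of "n + 1"] assms by simp
  also have "\<dots> \<le> 3 * ((2 * real n powr H) * (2 * ln (real n)))"
    using 1 2 l by (intro mult_left_mono mult_mono) auto
  finally have "mean_gain n \<le> 12 * (real n powr H / real n * ln (real n))" using assms by (simp add: field_simps)
  then show ?thesis using assms by (simp add: powr_diff)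
qed

text \<open>The bounds on \<open>mean_log\<close> differ by a factor \<open>ln n\<close>, so nearby
  values cannot be told apart. Stretching \<open>n\<close> by a factor \<open>m\<close> of order
  \<open>ln n powr (1 / H)\<close> makes the lower bound at \<open>m * n\<close> exceed the upper
  bound at \<open>n\<close> by at least \<open>n powr H\<close>. This growth is shared by
  \<open>(m - 1) * n\<close> gains, none larger than \<open>mean_gain n\<close>.\<close>

lemma mean_gain_lower:
  assumes "n \<ge> 3"
  shows "mean_gain n \<ge> real n powr (H - 1) / (2 * (32 * ln (real n)) powr (1 / H))"
proof -
  note l = ln_ge_1[OF assms]
  \<comment> \<open>32 = 8 * 4, where 8 comes from \<open>mean_log_ge\<close> and 4 is one more than
    the constant 3 of \<open>mean_log_le_ln\<close>.\<close>
  define b where "b = (32 * ln (real n)) powr (1 / H)"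
  have b: "1 \<le> b" unfolding b_def using l H by (intro ge_one_powr_ge_zero) auto
  define m where "m = nat \<lceil>b\<rceil>"
  have m: "b \<le> real m" "real m \<le> 2 * b" using b by (auto simp: m_def) linarith+
  have m1: "1 \<le> m" using m b by linarith
  have nm: "n + (m - 1) * n = m * n" using m1 by (cases m) auto
  have "32 * ln (real n) = b powr H" unfolding b_def using l H by (simp add: powr_powr)
  also have "\<dots> \<le> real m powr H" using b m H by (intro powr_mono2) auto
  finally have "4 * ln (real n) * real n powr H \<le> real m powr H * real n powr H / 8"
    using mult_right_mono[of "32 * ln (real n)" "real m powr H" "real n powr H"] by simp
  also have "\<dots> = real (m * n) powr H / 8" by (simp add: powr_mult)
  also have "m * n \<ge> 1 * 2" using m1 assms by (intro mult_mono) auto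
  then have "real (m * n) powr H / 8 \<le> mean_log (m * n)" using mean_log_ge[of "m * n"] by simp
  finally have "4 * (real n powr H * ln (real n)) \<le> mean_log (m * n)" by (simp add: mult_ac)
  moreover have "mean_log n \<le> 3 * (real n powr H * ln (real n))" by (rule mean_log_le_ln[OF assms])
  moreover have "real n powr H * 1 \<le> real n powr H * ln (real n)" using l by (intro mult_left_mono) auto
  moreover have "mean_log (m * n) - mean_log n \<le> real ((m - 1) * n) * mean_gain n"
    using mean_log_diff_le[of n "(m - 1) * n"] assms unfolding nm by simp
  ultimately have "real n powr H \<le> real ((m - 1) * n) * mean_gain n" by linarith
  also have "\<dots> \<le> (2 * b * real n) * mean_gain n"
  proof (rule mult_right_mono)
    show "0 \<le> mean_gain n" unfolding mean_gain_def using ln_expsum1_nonneg[of n] assms by (intro integral_nonneg_AE) auto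
    have "real ((m - 1) * n) \<le> real (m * n)" by (intro of_nat_mono mult_le_mono) auto
    also have "\<dots> = real m * real n" by simp
    also have "\<dots> \<le> 2 * b * real n" using m by (intro mult_right_mono) auto
    finally show "real ((m - 1) * n) \<le> 2 * b * real n" .
  qed
  finally have "real n powr H / real n / (2 * b) \<le> mean_gain n" using assms b by (simp add: field_simps)
  then show ?thesis using assms by (simp add: powr_diff b_def)
qed

text \<open>Tilting by \<open>Y a\<close> with \<open>a\<close> of order \<open>(ln n) powr (2 / H)\<close> pushes the walk below \<open>1 - ln n\<close> from
  time \<open>a\<close> on, since \<open>fbm_cov H k a \<ge> a powr (2 * H) / 2\<close> there. The cost is a constant factor,
  because the drift is small compared with the standard deviation of \<open>Y a\<close>. On the shifted event
  the exponential sum is at most of order \<open>a\<close>.\<close>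

lemma prob_max_le_1_upper:
  assumes n: "n \<ge> 3"
  shows "prob {\<omega> \<in> space M. \<forall>k\<in>{1..n}. Y k \<omega> \<le> 1} \<le> (72 * exp 5 + 2) * (real n powr (H - 1) * ln (real n) powr (2 / H + 1))"
proof -
  define h where "h = ln (real n)"
  have h: "1 \<le> h" using ln_ge_1[OF n] by (simp add: h_def)
  \<comment> \<open>The exponent gives \<open>\<sigma> \<ge> h\<^sup>2\<close>, so that
    \<open>l * Y a \<omega> \<ge> -2\<close> wherever
    \<open>Y a \<omega> \<ge> - (\<sigma> * h)\<close>.\<close>
  define b where "b = h powr (2 / H)"
  have b: "1 \<le> b" unfolding b_def using h H by (intro ge_one_powr_ge_zero) auto
  define a where "a = nat \<lceil>b\<rceil>"
  have a: "b \<le> real a" "real a + 1 \<le> 3 * b" using b by (auto simp: a_def) linarith+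
  have a1: "1 \<le> a" using a b by linarith
  define \<sigma> where "\<sigma> = real a powr H"
  have "h\<^sup>2 = b powr H" unfolding b_def using h H by (simp add: powr_powr powr_numeral)
  also have "\<dots> \<le> \<sigma>" unfolding \<sigma>_def using b a H by (intro powr_mono2) auto
  finally have \<sigma>h: "h\<^sup>2 \<le> \<sigma>" .
  have h2: "h \<le> h\<^sup>2" using h by (simp add: power2_eq_square)
  have \<sigma>: "1 \<le> \<sigma>" "h \<le> \<sigma>" using \<sigma>h h2 h by linarith+
  have \<sigma>2: "fbm_cov H (real a) (real a) = \<sigma>\<^sup>2" using powr_powr[of "real a" H 2] by (simp add: var_Y \<sigma>_def powr_numeral mult.commute)
  \<comment> \<open>Chosen so that \<open>l\<close> times half the variance of \<open>Y a\<close> is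
    \<open>h\<close>, the drift wanted from time \<open>a\<close> on.\<close>
  define l where "l = 2 * h / \<sigma>\<^sup>2"
  have l0: "l \<ge> 0" using h by (simp add: l_def)
  define E where "E = {\<omega> \<in> space M. \<forall>k\<in>{1..n}. Y k \<omega> \<le> 1}"
  define B where "B = {\<omega> \<in> space M. \<forall>k\<in>{1..n}. Y k \<omega> + l * fbm_cov H (real k) (real a) \<le> 1}"
  \<comment> \<open>The density is small only where \<open>Y a\<close> is very negative; this event
    is given away at the price of a probability at most \<open>2 / n\<close>.\<close>
  define F where "F = {\<omega> \<in> space M. Y a \<omega> \<le> - (\<sigma> * h)}"
  have [measurable]: "E \<in> sets M" "B \<in> sets M" "F \<in> sets M" unfolding E_def B_def F_def by measurable
  have "prob B = expectation (\<lambda>\<omega>. exp (l * Y a \<omega> - l\<^sup>2 * \<sigma>\<^sup>2 / 2) * indicator E \<omega>)"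
  proof -
    \<comment> \<open>\<open>a\<close> may exceed \<open>n\<close>; its coordinate then enters the
      vector without a constraint.\<close>
    let ?A = "\<lambda>k. if k \<in> {1..n} then {..1::real} else UNIV"
    have "B = {\<omega> \<in> space M. \<forall>k\<in>insert a {1..n}. Y k \<omega> + l * fbm_cov H (real k) (real a) \<in> ?A k}"
      by (auto simp: B_def)
    moreover have "E = {\<omega> \<in> space M. \<forall>k\<in>insert a {1..n}. Y k \<omega> \<in> ?A k}"
      by (auto simp: E_def)
    moreover have "0 < fbm_cov H (real a) (real a)" using \<sigma> by (simp add: \<sigma>2)
    ultimately show ?thesis using cameron_martin[of "insert a {1..n}" a ?A l] by (simp add: \<sigma>2)
  qed
  also have "\<dots> \<ge> expectation (\<lambda>\<omega>. exp (- 4) * indicator (E - F) \<omega>)"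
  proof (rule integral_mono)
    have ie: "integrable M (\<lambda>\<omega>. exp (l * Y a \<omega> - l\<^sup>2 * \<sigma>\<^sup>2 / 2))" unfolding exp_diff by simp
    show "integrable M (\<lambda>\<omega>. exp (l * Y a \<omega> - l\<^sup>2 * \<sigma>\<^sup>2 / 2) * indicator E \<omega>)"
      by (rule Bochner_Integration.integrable_bound[OF ie]) (auto simp: abs_mult indicator_def)
    fix \<omega> assume \<omega>: "\<omega> \<in> space M"
    show "exp (- 4) * indicator (E - F) \<omega> \<le> exp (l * Y a \<omega> - l\<^sup>2 * \<sigma>\<^sup>2 / 2) * indicator E \<omega>"
    proof (cases "\<omega> \<in> E - F")
      case True
      then have "- (\<sigma> * h) \<le> Y a \<omega>" using \<omega> by (auto simp: F_def)
      then have "l * - (\<sigma> * h) \<le> l * Y a \<omega>" using l0 by (rule mult_left_mono)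
      moreover have "l * (\<sigma> * h) = 2 * (h\<^sup>2 / \<sigma>)" using \<sigma> by (simp add: l_def power2_eq_square field_simps)
      moreover have "h\<^sup>2 / \<sigma> \<le> 1" using \<sigma>h \<sigma> by simp
      moreover have "l\<^sup>2 * \<sigma>\<^sup>2 / 2 = 2 * (h / \<sigma>)\<^sup>2" using \<sigma> by (simp add: l_def power_divide power_mult_distrib field_simps power4_eq_xxxx power2_eq_square)
      moreover have "(h / \<sigma>)\<^sup>2 \<le> 1\<^sup>2" using \<sigma> h by (intro power_mono) auto
      ultimately have "- 4 \<le> l * Y a \<omega> - l\<^sup>2 * \<sigma>\<^sup>2 / 2" by simp
      then show ?thesis using True by simp
    qed simp
  qed (simp add: integrable_indicat_real)
  also have "expectation (\<lambda>\<omega>. exp (- 4) * indicator (E - F) \<omega>) = exp (- 4) * prob (E - F)" by simp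
  finally have "exp (- 4) * prob (E - F) \<le> prob B" by simp
  then have "prob (E - F) \<le> exp 4 * prob B" by (simp add: exp_minus field_simps)
  moreover have "prob E \<le> prob (E - F) + prob F"
  proof -
    have "prob E \<le> prob ((E - F) \<union> F)" by (intro finite_measure_mono) auto
    also have "\<dots> \<le> prob (E - F) + prob F" by (intro measure_Un_le) auto
    finally show ?thesis .
  qed
  moreover have "prob F \<le> 2 / real n"
    using centered_gaussian_tail(2)[OF marginal, of a \<sigma> h] \<sigma> \<sigma>2 n by (simp add: F_def h_def exp_minus field_simps)
  moreover have "prob B \<le> 2 * exp 1 * (real a + 1) * mean_gain n"
  proof -
    \<comment> \<open>The times before \<open>a\<close> contribute at most \<open>exp 1\<close>
      each, and the terms \<open>exp (1 - h)\<close> of all \<open>n\<close> times add up to another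
      \<open>exp 1\<close>.\<close>
    define r where "r = exp 1 * (real a + 1)"
    have r: "2 \<le> r" unfolding r_def using exp_ge_add_one_self[of 1] a1 by (intro order_trans[OF _ mult_mono[of 2 "exp 1" 1]]) auto
    have "expectation (\<lambda>\<omega>. 1 / (2 * r) * indicator B \<omega>) \<le> mean_gain n"
      unfolding mean_gain_def
    proof (rule integral_mono)
      show "integrable M (\<lambda>\<omega>. ln (1 + 1 / expsum1 n \<omega>))" using ln_expsum1_integrable[of n] n by simp
      fix \<omega> assume "\<omega> \<in> space M"
      show "1 / (2 * r) * indicator B \<omega> \<le> ln (1 + 1 / expsum1 n \<omega>)"
      proof (cases "\<omega> \<in> B")
        case True
        have Yk: "exp (Y k \<omega>) \<le> (if k < a then exp 1 else 0) + exp (1 - h)" if k: "k \<in> {1..n}" for k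
        proof -
          have Y: "Y k \<omega> + l * fbm_cov H (real k) (real a) \<le> 1" using True k by (auto simp: B_def)
          show ?thesis
          proof (cases "k < a")
            case True
            have "0 \<le> l * fbm_cov H (real k) (real a)" using l0 fbm_cov_nonneg[of H "real k" "real a"] H by simp
            then have "Y k \<omega> \<le> 1" using Y by linarith
            then show ?thesis using True by (simp add: add_increasing2)
          next
            case False
            have "l * (\<sigma>\<^sup>2 / 2) \<le> l * fbm_cov H (real k) (real a)"
              using fbm_cov_ge[of H "real a" "real k"] H False l0 \<sigma>2 by (intro mult_left_mono) (auto simp: var_Y)
            moreover have "l * (\<sigma>\<^sup>2 / 2) = h" using \<sigma> by (simp add: l_def)
            ultimately have "Y k \<omega> \<le> 1 - h" using Y by linarith
            then show ?thesis using False by simp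
          qed
        qed
        have "expsum1 n \<omega> \<le> (\<Sum>k=1..n. (if k < a then exp 1 else 0) + exp (1 - h))"
          unfolding expsum1_def using Yk by (intro sum_mono)
        also have "\<dots> = (\<Sum>k\<in>{1..n} \<inter> {..<a}. exp 1) + real n * exp (1 - h)"
        proof -
          have "(\<Sum>k=1..n. if k < a then exp 1 else 0) = (\<Sum>k\<in>{1..n} \<inter> {..<a}. exp (1::real))"
            by (simp only: sum.inter_restrict finite_atLeastAtMost lessThan_iff)
          then show ?thesis unfolding sum.distrib by simp
        qed
        also have "(\<Sum>k\<in>{1..n} \<inter> {..<a}. exp 1) \<le> (\<Sum>k\<in>{..<a}. exp (1::real))"
          by (intro sum_mono2) auto
        also have "real n * exp (1 - h) = exp 1" using n by (simp add: h_def exp_diff)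
        finally have "expsum1 n \<omega> \<le> r" by (simp add: r_def algebra_simps)
        have expsum1: "0 < expsum1 n \<omega>" using expsum1_pos[of n \<omega>] n by simp
        \<comment> \<open>Since \<open>r \<ge> 2\<close>, the quadratic error takes away at most
          half of \<open>1 / r\<close>.\<close>
        have "1 / (2 * r) \<le> 1 / r - (1 / r)\<^sup>2" using r by (simp add: field_simps power2_eq_square)
        also have "\<dots> \<le> ln (1 + 1 / r)" using r by (intro ln_one_plus_pos_lower_bound) auto
        also have "\<dots> \<le> ln (1 + 1 / expsum1 n \<omega>)"
        proof -
          have "1 / r \<le> 1 / expsum1 n \<omega>" using \<open>expsum1 n \<omega> \<le> r\<close> expsum1 by (intro divide_left_mono) auto
          moreover have "0 < 1 / r" using r by simp
          ultimately show ?thesis by (subst ln_le_cancel_iff) linarith+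
        qed
        finally show ?thesis using True by simp
      qed (use ln_expsum1_nonneg[of n] n in auto)
    qed (simp add: integrable_indicat_real)
    then have "prob B / (2 * r) \<le> mean_gain n" by simp
    then show ?thesis using r by (simp add: r_def field_simps)
  qed
  ultimately have "prob E \<le> exp 4 * (2 * exp 1 * (real a + 1) * mean_gain n) + 2 / real n"
    by (smt (verit) exp_gt_zero mult_le_cancel_left_pos)
  also have "\<dots> = 2 * exp 5 * ((real a + 1) * mean_gain n) + 2 / real n"
    by (simp add: mult_exp_exp[of 4 1, simplified, symmetric])
  \<comment> \<open>The term \<open>2 / n\<close> is at most twice \<open>n powr (H - 1)\<close> and
    goes into the constant.\<close>
  also have "\<dots> \<le> 2 * exp 5 * ((3 * b) * (12 * (real n powr (H - 1) * h))) + 2 * (b * (real n powr (H - 1) * h))"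
  proof (intro add_mono mult_left_mono mult_mono)
    show "mean_gain n \<le> 12 * (real n powr (H - 1) * h)" using mean_gain_upper[OF n] by (simp add: h_def)
    show "0 \<le> mean_gain n" unfolding mean_gain_def using ln_expsum1_nonneg[of n] n by (intro integral_nonneg_AE) auto
    have "1 / real n = real n powr (- 1)" using n by (simp add: powr_minus_divide)
    also have "\<dots> \<le> real n powr (H - 1)" using n H by (intro powr_mono) auto
    also have "\<dots> \<le> b * (real n powr (H - 1) * h)"
    proof -
      have "1 * (real n powr (H - 1) * 1) \<le> b * (real n powr (H - 1) * h)" using b h by (intro mult_mono) auto
      then show ?thesis by simp
    qed
    finally show "2 / real n \<le> 2 * (b * (real n powr (H - 1) * h))" by simp
  qed (use a b h in auto)
  also have "\<dots> = (72 * exp 5 + 2) * (real n powr (H - 1) * (b * h))" by (simp add: algebra_simps)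
  also have "b * h = ln (real n) powr (2 / H + 1)" using h by (simp add: b_def h_def powr_add)
  finally show ?thesis by (simp add: E_def)
qed

text \<open>If the walk exceeds \<open>ln n\<close>, the sum is at least \<open>n\<close> and the
  integrand of \<open>mean_gain n\<close> at most \<open>1 / n\<close>. Otherwise the integrand is
  at most \<open>1 + \<bar>Y 1 \<omega>\<bar>\<close>, where cutting the modulus at
  \<open>ln n\<close> leaves a multiple of the persistence probability.\<close>

lemma prob_max_le_ln_lower:
  assumes n: "n \<ge> 3"
  shows "real n powr (H - 1) / (2 * (32 * ln (real n)) powr (1 / H)) \<le>
    (1 + ln (real n)) * prob {\<omega> \<in> space M. \<forall>k\<in>{1..n}. Y k \<omega> \<le> ln (real n)} + 19 / real n"
proof -
  define x where "x = ln (real n)"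
  have x: "1 \<le> x" using ln_ge_1[OF n] by (simp add: x_def)
  have ex: "exp (- x) = 1 / real n" using n by (simp add: x_def exp_minus divide_inverse)
  define E where "E = {\<omega> \<in> space M. \<forall>k\<in>{1..n}. Y k \<omega> \<le> x}"
  have [measurable]: "E \<in> sets M" unfolding E_def by measurable
  have e1: "exp (2::real) \<le> 9"
    using exp_double[of "1::real"] power_mono[OF exp_le, of 2] by simp
  define P where "P \<omega> = exp (2 * Y 1 \<omega>) + exp (-2 * Y 1 \<omega>)" for \<omega>
  have i: "integrable M P" unfolding P_def by (intro Bochner_Integration.integrable_add exp_Y_integrable)
  have "expectation P = expectation (\<lambda>\<omega>. exp (2 * Y 1 \<omega>)) + expectation (\<lambda>\<omega>. exp (-2 * Y 1 \<omega>))"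
    unfolding P_def by (intro Bochner_Integration.integral_add exp_Y_integrable)
  then have e: "expectation P = 2 * exp 2"
    using expectation_exp_Y[of 2 1] expectation_exp_Y[of "-2" 1] by simp
  \<comment> \<open>Beyond \<open>x\<close> one has
    \<open>\<bar>y\<bar> \<le> exp (2 * \<bar>y\<bar> - x)\<close>, so the exponential moments of
    \<open>Y 1\<close> make the mean excess of order \<open>1 / n\<close>.\<close>
  have bound: "\<bar>y\<bar> \<le> x + exp (- x) * (exp (2 * y) + exp (-2 * y))" for y
  proof (cases "\<bar>y\<bar> \<le> x")
    case True
    moreover have "0 \<le> exp (- x) * (exp (2 * y) + exp (-2 * y))" by (intro mult_nonneg_nonneg add_nonneg_nonneg) auto
    ultimately show ?thesis by linarith
  next
    case False
    have "\<bar>y\<bar> \<le> exp \<bar>y\<bar>" using exp_ge_add_one_self[of "\<bar>y\<bar>"] by linarith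
    also have "\<dots> \<le> exp (- x + 2 * \<bar>y\<bar>)" using False by simp
    also have "\<dots> = exp (- x) * exp (2 * \<bar>y\<bar>)" by (rule exp_add)
    also have "\<dots> \<le> exp (- x) * (exp (2 * y) + exp (-2 * y))"
      by (intro mult_left_mono) (auto simp: abs_if)
    finally show ?thesis using x by linarith
  qed
  have "mean_gain n \<le> expectation (\<lambda>\<omega>. (1 + x) * indicator E \<omega> + exp (- x) * P \<omega> + exp (- x))"
    unfolding mean_gain_def
  proof (rule integral_mono)
    show "integrable M (\<lambda>\<omega>. ln (1 + 1 / expsum1 n \<omega>))" using ln_expsum1_integrable[of n] n by simp
    show "integrable M (\<lambda>\<omega>. (1 + x) * indicator E \<omega> + exp (- x) * P \<omega> + exp (- x))"
      using i by (simp add: integrable_indicat_real)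
    fix \<omega> assume \<omega>: "\<omega> \<in> space M"
    have pos: "0 \<le> exp (- x) * P \<omega>" by (simp add: P_def add_nonneg_nonneg)
    show "ln (1 + 1 / expsum1 n \<omega>) \<le> (1 + x) * indicator E \<omega> + exp (- x) * P \<omega> + exp (- x)"
    proof (cases "\<omega> \<in> E")
      case True
      have "ln (1 + 1 / expsum1 n \<omega>) \<le> 1 + \<bar>Y 1 \<omega>\<bar>" using ln_expsum1_le[of n \<omega>] n by simp
      also have "\<dots> \<le> 1 + (x + exp (- x) * P \<omega>)" using bound[of "Y 1 \<omega>"] by (simp add: P_def)
      also have "\<dots> \<le> 1 + (x + exp (- x) * P \<omega>) + exp (- x)" by simp
      finally show ?thesis using True by simp
    next
      case False
      then obtain k where k: "k \<in> {1..n}" "x < Y k \<omega>" using \<omega> by (auto simp: E_def not_le)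
      have "exp x \<le> expsum1 n \<omega>" using exp_le_expsum1[of k n \<omega>] k by (smt (verit) atLeastAtMost_iff exp_less_mono)
      then have "1 / expsum1 n \<omega> \<le> exp (- x)" by (simp add: exp_minus divide_inverse le_imp_inverse_le)
      moreover have "ln (1 + 1 / expsum1 n \<omega>) \<le> 1 / expsum1 n \<omega>" using expsum1_pos[of n \<omega>] n by (intro ln_add_one_self_le_self) auto
      moreover have "indicat_real E \<omega> = 0" using False by simp
      ultimately show ?thesis using pos by simp
    qed
  qed
  also have "\<dots> = (1 + x) * prob E + exp (- x) * (2 * exp 2) + exp (- x)"
    using i e by (simp add: prob_space integrable_indicat_real)
  also have "\<dots> = (1 + x) * prob E + (2 * exp 2 + 1) / real n" by (simp add: ex add_divide_distrib)
  \<comment> \<open>19 = 2 * 9 + 1, with \<open>exp 2 \<le> 9\<close>.\<close>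
  also have "\<dots> \<le> (1 + x) * prob E + 19 / real n" using e1 by (intro add_mono divide_right_mono) auto
  finally show ?thesis using mean_gain_lower[OF n] by (simp add: E_def x_def)
qed

end

section \<open>From the grid to the path\<close>

text \<open>The grid points obtained by rounding \<open>t\<close> down tend to \<open>t\<close> and
  stay in the unit interval, so continuity carries the bound over.\<close>

lemma le_of_grid_le:
  fixes f :: "real \<Rightarrow> real"
  assumes f: "continuous_on {0..1} f" and n: "n \<ge> 1"
    and le: "\<And>m j. j \<le> n * 2 ^ m \<Longrightarrow> f (real j / real (n * 2 ^ m)) \<le> U" and t: "t \<in> {0..1}"
  shows "f t \<le> U"
proof -
  define r where "r m = real n * 2 ^ m" for m :: nat
  have r: "r m > 0" for m using n by (simp add: r_def)
  define p where "p m = real (nat \<lfloor>t * r m\<rfloor>) / r m" for m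
  have fl: "real (nat \<lfloor>t * r m\<rfloor>) \<le> t * r m" "t * r m - 1 < real (nat \<lfloor>t * r m\<rfloor>)" for m
    using t r[of m] by (auto simp: of_nat_nat mult_nonneg_nonneg less_imp_le)
  have p: "p m \<le> t" "t - 1 / r m \<le> p m" "0 \<le> p m" for m
  proof -
    show "p m \<le> t" "0 \<le> p m" using fl[of m] r[of m] by (auto simp: p_def pos_divide_le_eq)
    have "(t * r m - 1) / r m \<le> p m" unfolding p_def using fl[of m] r[of m] by (intro divide_right_mono) auto
    then show "t - 1 / r m \<le> p m" using r[of m] by (simp add: diff_divide_distrib)
  qed
  have pt: "p \<longlonglongrightarrow> t"
  proof (rule tendsto_sandwich[of "\<lambda>m. t - 1 / r m" _ _ "\<lambda>_. t"])
    have "(\<lambda>m. t - 1 / real n * (1 / 2) ^ m) \<longlonglongrightarrow> t - 1 / real n * 0"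
      by (intro tendsto_intros LIMSEQ_realpow_zero) auto
    then show "(\<lambda>m. t - 1 / r m) \<longlonglongrightarrow> t" by (simp add: r_def power_one_over)
  qed (use p in auto)
  have p01: "p m \<in> {0..1}" for m using p[of m] t by auto
  have "(\<lambda>m. f (p m)) \<longlonglongrightarrow> f t"
    using f t p01 pt by (auto intro!: continuous_on_tendsto_compose[OF f])
  moreover have "f (p m) \<le> U" for m
  proof -
    have "real (nat \<lfloor>t * r m\<rfloor>) \<le> r m" using p01[of m] r[of m] by (simp add: p_def)
    then have "real (nat \<lfloor>t * r m\<rfloor>) \<le> real (n * 2 ^ m)" by (simp add: r_def)
    then have "nat \<lfloor>t * r m\<rfloor> \<le> n * 2 ^ m" by (simp only: of_nat_le_iff)
    from le[OF this] show ?thesis by (simp add: p_def r_def)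
  qed
  ultimately show ?thesis by (intro LIMSEQ_le_const2) auto
qed

lemma fbm_cov_scale: "a > 0 \<Longrightarrow> fbm_cov H (s / a) (t / a) = fbm_cov H s t / a powr (2 * H)"
  using diff_divide_distrib[of s t a, symmetric]
  by (simp add: fbm_cov_def powr_divide) (simp add: diff_divide_distrib add_divide_distrib)

locale fractional_brownian = prob_space M
  for M :: "'a measure" +
  fixes H :: real and X :: "real \<Rightarrow> 'a \<Rightarrow> real"
  assumes H: "0 < H" "H < 1" and fbm: "fractional_brownian_motion M H X"
begin

sublocale centered_gaussian_process M "{0..}" X "fbm_cov H"
  using fbm by unfold_locales (auto simp: fractional_brownian_motion_def fbm_cov_def)

lemma X_meas[measurable]: "0 \<le> t \<Longrightarrow> X t \<in> borel_measurable M"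
  using measurable_process by simp

lemma X_continuous: "\<omega> \<in> space M \<Longrightarrow> continuous_on {0..} (\<lambda>t. X t \<omega>)"
  using fbm by (simp add: fractional_brownian_motion_def)

lemma X_continuous_unit: "\<omega> \<in> space M \<Longrightarrow> continuous_on {0..1} (\<lambda>t. X t \<omega>)"
  by (rule continuous_on_subset[OF X_continuous]) auto

lemma walk:
  assumes "n \<ge> 1"
  shows "fractional_walk M (\<lambda>k \<omega>. real n powr H * X (real k / real n) \<omega>) H"
proof -
  have eq: "real n powr H * real n powr H * fbm_cov H (real j / real n) (real k / real n) = fbm_cov H (real j) (real k)" for j k
    using assms by (simp add: fbm_cov_scale powr_add[symmetric])
  have "centered_gaussian_process M UNIV (\<lambda>k \<omega>. real n powr H * X (real k / real n) \<omega>) (\<lambda>j k. fbm_cov H (real j) (real k))"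
    using two_term_image[of "\<lambda>k. real k / real n" UNIV "\<lambda>_. 0" "\<lambda>_. real n powr H" "\<lambda>_. 0"]
    by (simp add: eq image_subset_iff)
  then show ?thesis by (intro fractional_walk.intro fractional_walk_axioms.intro H)
qed

text \<open>The increment has standard deviation \<open>(t - s) powr H\<close>. The factors 1 in the
  proof are the coefficients of \<open>two_term_image\<close>.\<close>

lemma increment_tail:
  assumes "0 \<le> s" "s < t"
  shows "prob {\<omega> \<in> space M. \<bar>X t \<omega> - X s \<omega>\<bar> \<ge> (t - s) powr H * y} \<le> 4 * exp (- y)"
proof -
  interpret D: centered_gaussian_process M "UNIV :: unit set" "\<lambda>_ \<omega>. 1 * X t \<omega> - 1 * X s \<omega>"
    "\<lambda>_ _. 1 * 1 * fbm_cov H t t - 1 * 1 * fbm_cov H t s - 1 * 1 * fbm_cov H s t + 1 * 1 * fbm_cov H s s"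
    using two_term_image[of "\<lambda>_. t" "UNIV :: unit set" "\<lambda>_. s" "\<lambda>_. 1" "\<lambda>_. 1"] assms by auto
  have v: "1 * 1 * fbm_cov H t t - 1 * 1 * fbm_cov H t s - 1 * 1 * fbm_cov H s t + 1 * 1 * fbm_cov H s s = ((t - s) powr H)\<^sup>2"
  proof -
    have "\<bar>t\<bar> = t" "\<bar>s\<bar> = s" "\<bar>t - s\<bar> = t - s" "\<bar>s - t\<bar> = t - s" using assms by auto
    moreover have "((t - s) powr H)\<^sup>2 = (t - s) powr (2 * H)"
      using powr_powr[of "t - s" H 2] assms by (simp add: powr_numeral mult.commute[of H])
    moreover have "a - (a + b - d) / 2 - (b + a - d) / 2 + b = d" for a b d :: real by argo
    ultimately show ?thesis by (simp add: fbm_cov_def)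
  qed
  note marg = D.gaussian_rv[OF UNIV_I] D.expectation_zero[OF UNIV_I] D.variance[OF UNIV_I]
  have "1 * 1 * fbm_cov H t t - 1 * 1 * fbm_cov H t s - 1 * 1 * fbm_cov H s t + 1 * 1 * fbm_cov H s s \<le> ((t - s) powr H)\<^sup>2"
    unfolding v by (rule order_refl)
  moreover have "0 < (t - s) powr H" using assms by simp
  ultimately have "prob {\<omega> \<in> space M. \<bar>1 * X t \<omega> - 1 * X s \<omega>\<bar> \<ge> (t - s) powr H * y} \<le> 4 * exp (- y)"
    by (rule centered_gaussian_tail(3)[OF marg])
  then show ?thesis unfolding mult_1 .
qed

section \<open>Chaining along dyadic refinements\<close>

definition incr :: "nat \<Rightarrow> nat \<Rightarrow> nat \<Rightarrow> 'a \<Rightarrow> real" where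
  "incr n m j \<omega> = X (real (Suc j) / real (n * 2 ^ m)) \<omega> - X (real j / real (n * 2 ^ m)) \<omega>"

text \<open>The power of \<open>n * 2 ^ m\<close> is the standard deviation of an increment of level
  \<open>m\<close>. The allowance \<open>Suc m\<close> is a compromise: it beats the number of
  increments in the union bound, yet the allowed increments have a finite sum over the
  levels.\<close>

definition bad :: "nat \<Rightarrow> real \<Rightarrow> 'a set" where
  "bad n x = (\<Union>m. \<Union>j\<in>{..<n * 2 ^ m}. {\<omega> \<in> space M. \<bar>incr n m j \<omega>\<bar> \<ge> real (n * 2 ^ m) powr - H * (x * real (Suc m))})"

lemma incr_meas[measurable]: "incr n m j \<in> borel_measurable M"
  unfolding incr_def by measurable

lemma bad_sets[measurable]: "bad n x \<in> sets M"
  unfolding bad_def by measurable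

text \<open>Level \<open>m\<close> has \<open>n * 2 ^ m\<close> increments, each bad with
  probability at most \<open>4 * exp (- x * (m + 1))\<close>. For \<open>x \<ge> 2\<close> these
  bounds decay at least like \<open>(1 / 2) ^ m\<close>, whence 8 = 4 * 2.\<close>

lemma prob_bad:
  assumes n: "n \<ge> 1" and x: "x \<ge> 2"
  shows "prob (bad n x) \<le> 8 * real n * exp (- x)"
proof -
  define B where "B m = (\<Union>j\<in>{..<n * 2 ^ m}. {\<omega> \<in> space M. \<bar>incr n m j \<omega>\<bar> \<ge> real (n * 2 ^ m) powr - H * (x * real (Suc m))})" for m
  have B[measurable]: "B m \<in> sets M" for m unfolding B_def by measurable
  have B_le: "prob (B m) \<le> 4 * real n * exp (- x) * (1 / 2) ^ m" for m
  proof -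
    define N where "N = n * 2 ^ m"
    have N: "N \<ge> 1" using n by (simp add: N_def)
    have "prob (B m) \<le> (\<Sum>j<N. prob {\<omega> \<in> space M. \<bar>incr n m j \<omega>\<bar> \<ge> real N powr - H * (x * real (Suc m))})"
      unfolding B_def N_def by (rule finite_measure_subadditive_finite) auto
    also have "\<dots> \<le> (\<Sum>j<N. 4 * exp (- (x * real (Suc m))))"
    proof (rule sum_mono)
      fix j
      have d: "real (Suc j) / real N - real j / real N = 1 / real N" using N by (simp add: field_simps)
      have "(1 / real N) powr H = real N powr - H" using N by (simp add: powr_divide powr_minus_divide)
      then show "prob {\<omega> \<in> space M. \<bar>incr n m j \<omega>\<bar> \<ge> real N powr - H * (x * real (Suc m))} \<le> 4 * exp (- (x * real (Suc m)))"
        using increment_tail[of "real j / real N" "real (Suc j) / real N" "x * real (Suc m)"] N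
        unfolding d incr_def N_def[symmetric] by (simp add: divide_strict_right_mono)
    qed
    also have "\<dots> = real n * 4 * exp (- x) * (2 ^ m * exp (- (x * real m)))"
      by (simp add: N_def algebra_simps exp_add[symmetric])
    also have "\<dots> \<le> real n * 4 * exp (- x) * (1 / 2) ^ m"
    proof (rule mult_left_mono)
      have "(2::real) \<le> exp 1" using exp_ge_add_one_self[of 1] by simp
      then have "2 * 2 \<le> exp 1 * exp (1::real)" by (intro mult_mono) auto
      also have "\<dots> \<le> exp x" using x by (simp add: mult_exp_exp)
      finally have "2 * exp (- x) \<le> 1 / 2" by (simp add: exp_minus field_simps)
      then have "(2 * exp (- x)) ^ m \<le> (1 / 2) ^ m" by (intro power_mono) auto
      moreover have "exp (- (x * real m)) = exp (- x) ^ m" by (simp add: exp_of_nat_mult[symmetric] mult.commute)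
      ultimately show "2 ^ m * exp (- (x * real m)) \<le> (1 / 2) ^ m" by (simp add: power_mult_distrib)
    qed auto
    finally show ?thesis by (simp add: mult_ac)
  qed
  have su: "summable (\<lambda>m. 4 * real n * exp (- x) * (1 / 2) ^ m)" by (intro summable_mult summable_geometric) simp
  have sB: "summable (\<lambda>m. prob (B m))"
    by (rule summable_comparison_test[OF _ su]) (use B_le in auto)
  have "prob (bad n x) = prob (\<Union>m. B m)" by (simp add: bad_def B_def)
  also have "\<dots> \<le> (\<Sum>m. prob (B m))" by (rule finite_measure_subadditive_countably) (use sB in auto)
  also have "\<dots> \<le> (\<Sum>m. 4 * real n * exp (- x) * (1 / 2) ^ m)" by (rule suminf_le[OF B_le sB su])
  also have "\<dots> = 4 * real n * exp (- x) * 2" by (subst suminf_mult) (auto simp: suminf_geometric summable_geometric)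
  finally show ?thesis by simp
qed

definition chain_const :: real where "chain_const = (\<Sum>m. real (Suc m) * (2 powr - H) ^ m)"

lemma chain_sum_le: "(\<Sum>i=1..m. real (Suc i) * (2 powr - H) ^ i) \<le> chain_const"
proof -
  have "summable (\<lambda>m. real (Suc m) * (2 powr - H) ^ m)"
    using geometric_deriv_sums[of "2 powr - H :: real"] powr_less_mono[of "- H" 0 2] H by (simp add: sums_iff)
  then show ?thesis unfolding chain_const_def by (rule sum_le_suminf) auto
qed

lemma chain_const_nonneg: "0 \<le> chain_const"
  using chain_sum_le[of 0] by simp

text \<open>A point of level \<open>m + 1\<close> lies in level \<open>m\<close> or has its left
  neighbour there, so reaching it from the coarse grid costs at most one increment per
  level.\<close>

lemma chaining:
  assumes \<omega>: "\<omega> \<in> space M" "\<omega> \<notin> bad n x" and n: "n \<ge> 1" and x: "x \<ge> 0"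
    and L: "\<And>j. j \<le> n \<Longrightarrow> X (real j / real n) \<omega> \<le> L" and t: "t \<in> {0..1}"
  shows "X t \<omega> \<le> L + real n powr - H * x * chain_const"
proof (rule le_of_grid_le[OF X_continuous_unit[OF \<omega>(1)] n _ t])
  let ?c = "real n powr - H * x"
  have step: "incr n m j \<omega> \<le> ?c * (real (Suc m) * (2 powr - H) ^ m)" if "j < n * 2 ^ m" for m j
  proof -
    have "incr n m j \<omega> \<le> real (n * 2 ^ m) powr - H * (x * real (Suc m))"
    proof (rule ccontr)
      assume "\<not> incr n m j \<omega> \<le> real (n * 2 ^ m) powr - H * (x * real (Suc m))"
      then have "\<omega> \<in> {\<omega> \<in> space M. \<bar>incr n m j \<omega>\<bar> \<ge> real (n * 2 ^ m) powr - H * (x * real (Suc m))}" using \<omega> by auto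
      then have "\<omega> \<in> bad n x" unfolding bad_def using that by blast
      then show False using \<omega> by simp
    qed
    also have "real (n * 2 ^ m) powr - H = real n powr - H * (2 powr - H) ^ m"
      by (simp add: powr_mult powr_power powr_realpow[symmetric] powr_powr mult.commute)
    finally show ?thesis by (simp add: mult_ac)
  qed
  have main: "X (real j / real (n * 2 ^ m)) \<omega> \<le> L + ?c * (\<Sum>i=1..m. real (Suc i) * (2 powr - H) ^ i)"
    if "j \<le> n * 2 ^ m" for m j
    using that
  proof (induction m arbitrary: j)
    case 0
    then show ?case using L by simp
  next
    case (Suc m)
    have half: "real (2 * i) / real (n * 2 ^ Suc m) = real i / real (n * 2 ^ m)" for i by simp
    have pos: "0 \<le> ?c * (real (Suc (Suc m)) * (2 powr - H) ^ Suc m)" using x by simp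
    have split: "L + ?c * (\<Sum>i=1..Suc m. real (Suc i) * (2 powr - H) ^ i)
        = L + ?c * (\<Sum>i=1..m. real (Suc i) * (2 powr - H) ^ i) + ?c * (real (Suc (Suc m)) * (2 powr - H) ^ Suc m)"
      by (simp add: distrib_left)
    show ?case
    proof (cases "even j")
      case True
      then obtain i where i: "j = 2 * i" by (auto elim: evenE)
      have "X (real i / real (n * 2 ^ m)) \<omega> \<le> L + ?c * (\<Sum>i=1..m. real (Suc i) * (2 powr - H) ^ i)"
        using Suc.prems by (intro Suc.IH) (simp add: i)
      then show ?thesis unfolding split i half using pos by linarith
    next
      case False
      then obtain i where i: "j = Suc (2 * i)" by (auto elim: oddE)
      have "X (real i / real (n * 2 ^ m)) \<omega> \<le> L + ?c * (\<Sum>i=1..m. real (Suc i) * (2 powr - H) ^ i)"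
        using Suc.prems by (intro Suc.IH) (simp add: i)
      moreover have "incr n (Suc m) (2 * i) \<omega> \<le> ?c * (real (Suc (Suc m)) * (2 powr - H) ^ Suc m)"
        using Suc.prems by (intro step) (simp add: i)
      moreover have "incr n (Suc m) (2 * i) \<omega> = X (real j / real (n * 2 ^ Suc m)) \<omega> - X (real i / real (n * 2 ^ m)) \<omega>"
        unfolding incr_def half i ..
      ultimately show ?thesis unfolding split by linarith
    qed
  qed
  show "X (real j / real (n * 2 ^ m)) \<omega> \<le> L + ?c * chain_const" if "j \<le> n * 2 ^ m" for m j
  proof -
    have "?c * (\<Sum>i=1..m. real (Suc i) * (2 powr - H) ^ i) \<le> ?c * chain_const"
      using x by (intro mult_left_mono chain_sum_le) auto
    then show ?thesis using main[OF that] by linarith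
  qed
qed

lemma Sup_le_iff:
  assumes "\<omega> \<in> space M"
  shows "(SUP t\<in>{0..1}. X t \<omega>) \<le> u \<longleftrightarrow> (\<forall>t\<in>{0..1}. X t \<omega> \<le> u)"
proof (rule cSUP_le_iff)
  show "bdd_above ((\<lambda>t. X t \<omega>) ` {0..1})"
    by (intro bounded_imp_bdd_above compact_imp_bounded compact_continuous_image X_continuous_unit assms) simp
qed simp

text \<open>Continuity reduces the supremum to countably many dyadic times. Measurability matters
  for the lower bound, where this is the larger event in a comparison of probabilities.\<close>

lemma Sup_sets: "{\<omega> \<in> space M. (SUP t\<in>{0..1}. X t \<omega>) \<le> u} \<in> sets M"
proof -
  have "{\<omega> \<in> space M. (SUP t\<in>{0..1}. X t \<omega>) \<le> u} = {\<omega> \<in> space M. \<forall>m. \<forall>j\<in>{..2 ^ m :: nat}. X (real j / real (2 ^ m)) \<omega> \<le> u}"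
    (is "?L = ?R")
  proof
    show "?L \<subseteq> ?R" by (auto simp: Sup_le_iff)
    show "?R \<subseteq> ?L"
      using le_of_grid_le[OF X_continuous_unit, where n=1] by (auto simp: Sup_le_iff)
  qed
  also have "\<dots> \<in> sets M" by measurable
  finally show ?thesis .
qed

lemma prob_Sup_upper:
  assumes n: "n \<ge> 3" and e: "real n powr H * \<epsilon> \<le> 1"
  shows "prob {\<omega> \<in> space M. (SUP t\<in>{0..1}. X t \<omega>) \<le> \<epsilon>} \<le> (72 * exp 5 + 2) * (real n powr (H - 1) * ln (real n) powr (2 / H + 1))"
proof -
  interpret W: fractional_walk M "\<lambda>k \<omega>. real n powr H * X (real k / real n) \<omega>" H
    using n by (intro walk) simp
  have "{\<omega> \<in> space M. (SUP t\<in>{0..1}. X t \<omega>) \<le> \<epsilon>} \<subseteq> {\<omega> \<in> space M. \<forall>k\<in>{1..n}. real n powr H * X (real k / real n) \<omega> \<le> 1}"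
  proof safe
    fix \<omega> k assume \<omega>: "\<omega> \<in> space M" "(SUP t\<in>{0..1}. X t \<omega>) \<le> \<epsilon>" and k: "k \<in> {1..n}"
    then have "X (real k / real n) \<omega> \<le> \<epsilon>" using Sup_le_iff[OF \<omega>(1), of \<epsilon>] by auto
    then have "real n powr H * X (real k / real n) \<omega> \<le> real n powr H * \<epsilon>" by (intro mult_left_mono) auto
    then show "real n powr H * X (real k / real n) \<omega> \<le> 1" using e by linarith
  qed
  then have "prob {\<omega> \<in> space M. (SUP t\<in>{0..1}. X t \<omega>) \<le> \<epsilon>} \<le> prob {\<omega> \<in> space M. \<forall>k\<in>{1..n}. real n powr H * X (real k / real n) \<omega> \<le> 1}"
    by (intro finite_measure_mono) measurable
  also have "\<dots> \<le> (72 * exp 5 + 2) * (real n powr (H - 1) * ln (real n) powr (2 / H + 1))"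
    by (rule W.prob_max_le_1_upper[OF n])
  finally show ?thesis .
qed

text \<open>When the walk stays below \<open>ln n\<close>, chaining with \<open>x = 3 * ln n\<close>
  keeps the whole path below the level in the hypothesis. The factor 3 brings the exceptional
  probability down to \<open>8 / n\<^sup>2\<close>, of smaller order than the main term.\<close>

lemma prob_Sup_lower:
  assumes n: "n \<ge> 3" and e: "real n powr - H * ((1 + 3 * chain_const) * ln (real n)) \<le> \<epsilon>"
  shows "(real n powr (H - 1) / (2 * (32 * ln (real n)) powr (1 / H)) - 19 / real n) / (1 + ln (real n)) - 8 / (real n)\<^sup>2
    \<le> prob {\<omega> \<in> space M. (SUP t\<in>{0..1}. X t \<omega>) \<le> \<epsilon>}"
proof -
  interpret W: fractional_walk M "\<lambda>k \<omega>. real n powr H * X (real k / real n) \<omega>" H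
    using n by (intro walk) simp
  define x where "x = ln (real n)"
  have x: "1 \<le> x" using ln_ge_1[OF n] by (simp add: x_def)
  define E where "E = {\<omega> \<in> space M. \<forall>k\<in>{1..n}. real n powr H * X (real k / real n) \<omega> \<le> x}"
  let ?G = "{\<omega> \<in> space M. (SUP t\<in>{0..1}. X t \<omega>) \<le> \<epsilon>}"
  have [measurable]: "E \<in> sets M" unfolding E_def using W.Y_meas by measurable
  have q: "real n powr H > 0" "real n powr - H * real n powr H = 1" using n by (auto simp: powr_minus)
  have "AE \<omega> in M. \<omega> \<in> E - bad n (3 * x) \<longrightarrow> \<omega> \<in> ?G"
    using W.Y_0
  proof eventually_elim
    case (elim \<omega>)
    show ?case
    proof
      assume \<omega>: "\<omega> \<in> E - bad n (3 * x)"
      then have \<omega>M: "\<omega> \<in> space M" by (simp add: E_def)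
      have L: "X (real j / real n) \<omega> \<le> real n powr - H * x" if "j \<le> n" for j
      proof -
        \<comment> \<open>Time 0 is not constrained by \<open>E\<close>; there the walk vanishes
          almost surely, whence an inclusion only up to a null set.\<close>
        have "real n powr H * X (real j / real n) \<omega> \<le> x" using \<omega> elim x that by (cases "j = 0") (auto simp: E_def)
        then have "real n powr - H * (real n powr H * X (real j / real n) \<omega>) \<le> real n powr - H * x"
          by (intro mult_left_mono) auto
        then show ?thesis using q by (simp add: mult.assoc[symmetric])
      qed
      have "X t \<omega> \<le> \<epsilon>" if t: "t \<in> {0..1}" for t
      proof -
        have "X t \<omega> \<le> real n powr - H * x + real n powr - H * (3 * x) * chain_const"
          by (rule chaining[OF \<omega>M _ _ _ L t]) (use \<omega> n x in auto)
        also have "\<dots> = real n powr - H * ((1 + 3 * chain_const) * ln (real n))" by (simp add: x_def algebra_simps)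
        finally show ?thesis using e by simp
      qed
      then show "\<omega> \<in> ?G" using \<omega>M by (simp add: Sup_le_iff)
    qed
  qed
  then have "prob (E - bad n (3 * x)) \<le> prob ?G" using Sup_sets by (intro finite_measure_mono_AE) auto
  moreover have "prob E \<le> prob (E - bad n (3 * x)) + prob (bad n (3 * x))"
  proof -
    have "prob E \<le> prob ((E - bad n (3 * x)) \<union> bad n (3 * x))" by (intro finite_measure_mono) auto
    also have "\<dots> \<le> prob (E - bad n (3 * x)) + prob (bad n (3 * x))" by (intro measure_Un_le) auto
    finally show ?thesis .
  qed
  moreover have "prob (bad n (3 * x)) \<le> 8 / (real n)\<^sup>2"
  proof -
    have "exp (- (3 * x)) = 1 / real n ^ 3"
      using n exp_of_nat_mult[of 3 "- x"] by (simp add: x_def exp_minus divide_inverse power_inverse)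
    moreover have "8 * real n * (1 / real n ^ 3) = 8 / (real n)\<^sup>2" using n by (simp add: power2_eq_square power3_eq_cube)
    ultimately show ?thesis using prob_bad[of n "3 * x"] n x by simp
  qed
  moreover have "(real n powr (H - 1) / (2 * (32 * x) powr (1 / H)) - 19 / real n) / (1 + x) \<le> prob E"
  proof -
    have "real n powr (H - 1) / (2 * (32 * x) powr (1 / H)) \<le> (1 + x) * prob E + 19 / real n"
      using W.prob_max_le_ln_lower[OF n] by (simp add: E_def x_def)
    then have "real n powr (H - 1) / (2 * (32 * x) powr (1 / H)) - 19 / real n \<le> prob E * (1 + x)"
      by (simp add: mult.commute)
    then show ?thesis using x by (subst pos_divide_le_eq) auto
  qed
  ultimately show ?thesis by (simp add: x_def)
qed

end

section \<open>From grid size to level\<close>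

lemma lower_rate_eventually:
  fixes H :: real
  assumes "0 < H" "H < 1"
  shows "eventually (\<lambda>n::nat. real n powr (H - 1) * ln (real n) powr (- (1 / H + 2))
     \<le> (real n powr (H - 1) / (2 * (32 * ln (real n)) powr (1 / H)) - 19 / real n) / (1 + ln (real n)) - 8 / (real n)\<^sup>2) sequentially"
  \<comment> \<open>The main term has order \<open>n powr (H - 1) * ln n powr (- 1 / H - 1)\<close>,
    so the left side has a spare power of the logarithm to beat the constants. The corrections are
    of smaller order because \<open>H > 0\<close>.\<close>
  using assms by real_asymp

lemma eventually_neg_ln_ge: "eventually (\<lambda>\<epsilon>. l0 \<le> - ln \<epsilon>) (at_right (0::real))"
proof -
  have "filterlim (\<lambda>\<epsilon>::real. - ln \<epsilon>) at_top (at_right 0)" by real_asymp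
  then show ?thesis by (simp add: filterlim_at_top)
qed

context fractional_brownian
begin

text \<open>With \<open>n\<close> just below \<open>\<epsilon> powr (- 1 / H)\<close>, the level
  \<open>\<epsilon>\<close> becomes at most 1 for the walk.\<close>

lemma small_ball_upper:
  "eventually (\<lambda>\<epsilon>. prob {\<omega> \<in> space M. (SUP t\<in>{0..1}. X t \<omega>) \<le> \<epsilon>} \<le> \<epsilon> powr ((1 - H) / H) * \<bar>ln \<epsilon>\<bar> powr (2 / H + 2)) (at_right 0)"
proof -
  \<comment> \<open>Collects all constants; near 0 one more power of
    \<open>\<bar>ln \<epsilon>\<bar>\<close> absorbs them.\<close>
  define C where "C = 2 * (72 * exp 5 + 2) * (1 / H) powr (2 / H + 1)"
  have "eventually (\<lambda>\<epsilon>. max 6 C \<le> - ln \<epsilon>) (at_right (0::real))" by (rule eventually_neg_ln_ge)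
  moreover have "eventually (\<lambda>\<epsilon>::real. 0 < \<epsilon>) (at_right 0)" by (simp add: eventually_at_right_less)
  ultimately show ?thesis
  proof eventually_elim
    case (elim \<epsilon>)
    define l where "l = - ln \<epsilon>"
    have \<epsilon>: "\<epsilon> = exp (- l)" and l: "6 \<le> l" "C \<le> l" using elim by (auto simp: l_def)
    define y where "y = exp (l / H)"
    have "l * 1 \<le> l * (1 / H)" using l H by (intro mult_left_mono) auto
    then have "l \<le> l / H" by simp
    then have y: "6 \<le> y" unfolding y_def using l exp_ge_add_one_self[of "l / H"] by linarith
    define n where "n = nat \<lfloor>y\<rfloor>"
    have n: "real n \<le> y" "y / 2 \<le> real n" "3 \<le> n" using y by (auto simp: n_def) linarith+
    have "real n powr H \<le> y powr H" using n H by (intro powr_mono2) auto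
    also have "\<dots> = exp l" using H by (simp add: y_def powr_def)
    finally have "real n powr H * \<epsilon> \<le> exp l * \<epsilon>" by (intro mult_right_mono) (auto simp: \<epsilon>)
    then have "real n powr H * \<epsilon> \<le> 1" by (simp add: \<epsilon> mult_exp_exp)
    from prob_Sup_upper[OF n(3) this]
    have "prob {\<omega> \<in> space M. (SUP t\<in>{0..1}. X t \<omega>) \<le> \<epsilon>} \<le> (72 * exp 5 + 2) * (real n powr (H - 1) * ln (real n) powr (2 / H + 1))" .
    also have "\<dots> \<le> (72 * exp 5 + 2) * ((2 * \<epsilon> powr ((1 - H) / H)) * ((1 / H) powr (2 / H + 1) * l powr (2 / H + 1)))"
    proof (intro mult_left_mono mult_mono)
      \<comment> \<open>\<open>H - 1\<close> is negative, so the bound \<open>y / 2 \<le> n\<close>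
        is the one that counts.\<close>
      have "real n powr (H - 1) \<le> (y / 2) powr (H - 1)" using n y H by (intro powr_mono2') auto
      also have "\<dots> = y powr (H - 1) * 2 powr (1 - H)" using y by (simp add: powr_divide powr_diff field_simps)
      also have "\<dots> \<le> y powr (H - 1) * 2" using H powr_mono[of "1 - H" 1 "2::real"] by (intro mult_left_mono) auto
      also have "y powr (H - 1) = \<epsilon> powr ((1 - H) / H)" using H by (simp add: y_def \<epsilon> powr_def field_simps)
      finally show "real n powr (H - 1) \<le> 2 * \<epsilon> powr ((1 - H) / H)" by simp
      have "ln (real n) \<le> ln y" using n y by (subst ln_le_cancel_iff) auto
      then have "ln (real n) \<le> 1 / H * l" by (simp add: y_def)
      then have "ln (real n) powr (2 / H + 1) \<le> (1 / H * l) powr (2 / H + 1)" using ln_ge_1[OF n(3)] H by (intro powr_mono2) auto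
      then show "ln (real n) powr (2 / H + 1) \<le> (1 / H) powr (2 / H + 1) * l powr (2 / H + 1)" by (simp only: powr_mult)
    qed auto
    also have "\<dots> = \<epsilon> powr ((1 - H) / H) * (C * l powr (2 / H + 1))" by (simp add: C_def mult_ac)
    also have "\<dots> \<le> \<epsilon> powr ((1 - H) / H) * (l * l powr (2 / H + 1))" using l by (intro mult_left_mono mult_right_mono) auto
    also have "l * l powr (2 / H + 1) = l powr (2 / H + 2)" using l powr_add[of l 1 "2 / H + 1"] by (simp add: add_ac)
    also have "l = \<bar>ln \<epsilon>\<bar>" using l by (simp add: \<epsilon>)
    finally show ?case .
  qed
qed

text \<open>The walk is only known to stay below \<open>ln n\<close>, so the grid must be finer than
  \<open>\<epsilon> powr (- 1 / H)\<close> by a power of the logarithm.\<close>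

lemma small_ball_lower:
  "eventually (\<lambda>\<epsilon>. \<epsilon> powr ((1 - H) / H) * \<bar>ln \<epsilon>\<bar> powr (- (3 / H + 3)) \<le> prob {\<omega> \<in> space M. (SUP t\<in>{0..1}. X t \<omega>) \<le> \<epsilon>}) (at_right 0)"
proof -
  define D where "D = 3 * (1 + 3 * chain_const) / H"
  define p where "p = 1 / H + 2"
  define C where "C = 2 * (3 / H) powr p"
  obtain N where N: "\<And>n. n \<ge> N \<Longrightarrow> real n powr (H - 1) * ln (real n) powr (- p)
     \<le> (real n powr (H - 1) / (2 * (32 * ln (real n)) powr (1 / H)) - 19 / real n) / (1 + ln (real n)) - 8 / (real n)\<^sup>2"
    using lower_rate_eventually[OF H] unfolding p_def eventually_sequentially by blast
  have "eventually (\<lambda>\<epsilon>. max (max 3 (real N)) (max C D) \<le> - ln \<epsilon>) (at_right (0::real))" by (rule eventually_neg_ln_ge)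
  moreover have "eventually (\<lambda>\<epsilon>::real. 0 < \<epsilon>) (at_right 0)" by (simp add: eventually_at_right_less)
  ultimately show ?thesis
  proof eventually_elim
    case (elim \<epsilon>)
    define l where "l = - ln \<epsilon>"
    have \<epsilon>: "\<epsilon> = exp (- l)" and l: "3 \<le> l" "real N \<le> l" "C \<le> l" "D \<le> l" using elim by (auto simp: l_def)
    \<comment> \<open>The factor \<open>l powr (2 / H)\<close> gives
      \<open>n powr - H \<le> \<epsilon> / l\<^sup>2\<close>; the path then stays below
      \<open>\<epsilon> * D / l \<le> \<epsilon>\<close>.\<close>
    define y where "y = exp (l / H) * l powr (2 / H)"
    have "l * 1 \<le> l * (1 / H)" using l H by (intro mult_left_mono) auto
    then have "l \<le> l / H" by simp
    then have "l \<le> exp (l / H)" using exp_ge_add_one_self[of "l / H"] by linarith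
    moreover have "1 \<le> l powr (2 / H)" using l H by (intro ge_one_powr_ge_zero) auto
    ultimately have y: "l \<le> y" using l mult_mono[of l "exp (l / H)" 1 "l powr (2 / H)"] by (simp add: y_def)
    define n where "n = nat \<lceil>y\<rceil>"
    have n: "y \<le> real n" "real n \<le> 2 * y" using y l by (auto simp: n_def) linarith+
    have n3: "3 \<le> n" "N \<le> n" using n y l by linarith+
    have "ln (real n) \<le> ln (2 * y)" using n y l by (subst ln_le_cancel_iff) auto
    also have "\<dots> = ln 2 + l / H + 2 / H * ln l" using l by (simp add: y_def ln_mult_pos ln_powr)
    also have "\<dots> \<le> 3 / H * l"
    proof -
      have "ln 2 \<le> (1::real)" using ln_le_minus_one[of "2::real"] by simp
      moreover have "2 / H * ln l \<le> 2 / H * (l - 1)" using ln_le_minus_one[of l] l H by (intro mult_left_mono) auto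
      moreover have "1 \<le> 2 / H" using H by simp
      moreover have "2 / H * (l - 1) = 2 * (l / H) - 2 / H" "3 / H * l = 3 * (l / H)"
        by (simp_all add: right_diff_distrib)
      ultimately show ?thesis by linarith
    qed
    finally have ln_n: "ln (real n) \<le> 3 / H * l" .
    have "real n powr - H \<le> y powr - H" using n y l H by (intro powr_mono2') auto
    also have "\<dots> = \<epsilon> * l powr - 2" using H by (simp add: y_def \<epsilon> powr_mult powr_powr powr_def[of "exp _"])
    finally have nH: "real n powr - H \<le> \<epsilon> * l powr - 2" .
    have "real n powr - H * ((1 + 3 * chain_const) * ln (real n)) \<le> \<epsilon> * l powr - 2 * ((1 + 3 * chain_const) * (3 / H * l))"
      using nH ln_n chain_const_nonneg ln_ge_1[OF n3(1)] by (intro mult_mono mult_nonneg_nonneg) (auto simp: \<epsilon>)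
    also have "\<dots> = \<epsilon> * (D * (l powr - 2 * l))" by (simp add: D_def)
    also have "l powr - 2 * l = 1 / l" using l by (simp add: powr_minus powr_numeral power2_eq_square divide_inverse)
    also have "\<epsilon> * (D * (1 / l)) \<le> \<epsilon> * 1" using l by (intro mult_left_mono) (auto simp: \<epsilon>)
    finally have "real n powr - H * ((1 + 3 * chain_const) * ln (real n)) \<le> \<epsilon>" by simp
    note P = prob_Sup_lower[OF n3(1) this]
    have p0: "0 \<le> p" using H by (simp add: p_def)
    \<comment> \<open>The exponent \<open>3 / H + 3\<close> is the sum of \<open>2 / H\<close> for
      the finer grid, \<open>p\<close> for the rate and 1 to absorb \<open>C\<close>.\<close>
    have "\<epsilon> powr ((1 - H) / H) * l powr (- (3 / H + 3)) \<le> (1 / 2 * \<epsilon> powr ((1 - H) / H) * l powr (- (2 / H))) * ((3 / H) powr - p * l powr - p)"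
    proof -
      have "C * l powr (- (3 / H + 3)) \<le> l * l powr (- (3 / H + 3))" using l by (intro mult_right_mono) auto
      also have "\<dots> = l powr (1 + - (3 / H + 3))" using l powr_add[of l 1 "- (3 / H + 3)"] by simp
      also have "1 + - (3 / H + 3) = - (2 / H) + - p" by (simp add: p_def)
      also have "l powr (- (2 / H) + - p) = l powr (- (2 / H)) * l powr - p" by (rule powr_add)
      finally have "C * l powr (- (3 / H + 3)) \<le> l powr (- (2 / H)) * l powr - p" .
      moreover have "0 < C" using H by (simp add: C_def)
      ultimately have "l powr (- (3 / H + 3)) \<le> l powr (- (2 / H)) * l powr - p / C"
        by (metis pos_le_divide_eq mult.commute)
      also have "\<dots> = 1 / 2 * (3 / H) powr - p * (l powr (- (2 / H)) * l powr - p)"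
      proof -
        have "inverse C = 1 / 2 * (3 / H) powr - p"
          unfolding C_def powr_minus inverse_mult_distrib by simp
        then show ?thesis by (metis divide_inverse mult.commute)
      qed
      finally have "\<epsilon> powr ((1 - H) / H) * l powr (- (3 / H + 3)) \<le> \<epsilon> powr ((1 - H) / H) * (1 / 2 * (3 / H) powr - p * (l powr (- (2 / H)) * l powr - p))"
        by (rule mult_left_mono) simp
      then show ?thesis by (simp add: mult_ac)
    qed
    also have "\<dots> \<le> real n powr (H - 1) * ln (real n) powr - p"
    proof (rule mult_mono)
      have "(3 / H * l) powr - p \<le> ln (real n) powr - p" using ln_n ln_ge_1[OF n3(1)] p0 by (intro powr_mono2') auto
      then show "(3 / H) powr - p * l powr - p \<le> ln (real n) powr - p" by (simp only: powr_mult)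
      \<comment> \<open>The finer grid costs the exponent
        \<open>2 / H * (H - 1) = 2 - 2 / H\<close>; its 2 is given away.\<close>
      have "l powr (- (2 / H)) \<le> l powr (2 / H * (H - 1))" using l H by (intro powr_mono) (auto simp: field_simps)
      then have "1 / 2 * \<epsilon> powr ((1 - H) / H) * l powr (- (2 / H)) \<le> 2 powr (H - 1) * \<epsilon> powr ((1 - H) / H) * l powr (2 / H * (H - 1))"
        using H powr_mono[of "- 1" "H - 1" "2::real"] by (intro mult_mono) (auto simp: powr_minus)
      also have "\<dots> = (2 * y) powr (H - 1)"
        using H by (simp add: y_def \<epsilon> powr_mult powr_powr powr_def[of "exp _"] field_simps)
      also have "\<dots> \<le> real n powr (H - 1)" using n y l H by (intro powr_mono2') auto
      finally show "1 / 2 * \<epsilon> powr ((1 - H) / H) * l powr (- (2 / H)) \<le> real n powr (H - 1)" .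
    qed auto
    also note N[OF n3(2)]
    also note P
    also have "l = \<bar>ln \<epsilon>\<bar>" using l by (simp add: \<epsilon>)
    finally show ?case .
  qed
qed

end

theorem corollary2:
  fixes M :: "'a measure" and H :: real and X :: "real \<Rightarrow> 'a \<Rightarrow> real"
  assumes "prob_space M"
    and "0 < H" and "H < 1"
    and "fractional_brownian_motion M H X"
  shows "\<exists>c>0. \<forall>\<^sub>F \<epsilon> in at_right 0.
     \<epsilon> powr ((1 - H) / H) * \<bar>ln \<epsilon>\<bar> powr (- c)
       \<le> prob_space.prob M {\<omega> \<in> space M. (SUP t\<in>{0..1}. X t \<omega>) \<le> \<epsilon>} \<and>
     prob_space.prob M {\<omega> \<in> space M. (SUP t\<in>{0..1}. X t \<omega>) \<le> \<epsilon>}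
       \<le> \<epsilon> powr ((1 - H) / H) * \<bar>ln \<epsilon>\<bar> powr c"
proof (intro exI conjI)
  interpret fractional_brownian M H X
    using assms by (intro fractional_brownian.intro fractional_brownian_axioms.intro)
  \<comment> \<open>The lower bound dictates the exponent; the upper bound is weakened to it once
    \<open>\<bar>ln \<epsilon>\<bar> \<ge> 1\<close>.\<close>
  show "0 < 3 / H + 3" using H by (simp add: add_pos_pos)
  show "\<forall>\<^sub>F \<epsilon> in at_right 0.
     \<epsilon> powr ((1 - H) / H) * \<bar>ln \<epsilon>\<bar> powr (- (3 / H + 3)) \<le> prob {\<omega> \<in> space M. (SUP t\<in>{0..1}. X t \<omega>) \<le> \<epsilon>} \<and>
     prob {\<omega> \<in> space M. (SUP t\<in>{0..1}. X t \<omega>) \<le> \<epsilon>} \<le> \<epsilon> powr ((1 - H) / H) * \<bar>ln \<epsilon>\<bar> powr (3 / H + 3)"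
    using small_ball_lower small_ball_upper eventually_neg_ln_ge[of 1]
  proof eventually_elim
    case (elim \<epsilon>)
    have "2 / H \<le> 3 / H" using H by (intro divide_right_mono) auto
    then have "\<bar>ln \<epsilon>\<bar> powr (2 / H + 2) \<le> \<bar>ln \<epsilon>\<bar> powr (3 / H + 3)"
      using elim(3) by (intro powr_mono) linarith+
    then have "\<epsilon> powr ((1 - H) / H) * \<bar>ln \<epsilon>\<bar> powr (2 / H + 2) \<le> \<epsilon> powr ((1 - H) / H) * \<bar>ln \<epsilon>\<bar> powr (3 / H + 3)"
      by (rule mult_left_mono) simp
    with elim show ?case by linarith
  qed
qed

end
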